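(* Let $\mathbb G=V_1\times V_2$ be a step-two Carnot group of rank $r$. (a) Let $f\in\mathcal A_h(\mathbb G)$. Then for every $(x,z)\in\mathbb G$ the map $t\in(0,+\infty)\mapsto(f\circ\delta_t)(x,z)$ is a polynomial of degree $\leq r$; denote its coefficients by $f_j(x,z):=\frac{1}{j!}\frac{d^j}{dt^j}(f\circ\delta_t)(x,z)\big|_{t=0}$. (b) Let $n\geq r$ be an integer and $\pi:\mathbb F_n\to\mathbb G$ a surjective Carnot morphism. For each $k\in\{0,\dots,n\}$ and each $\eta\in\Lambda^k(\pi)$ there is a unique map $\psi_\eta:\mathbb G\to\Lambda^n(\mathbb R^n)\cong\mathbb R$ with $\widetilde\psi_\eta=\psi_\eta\circ\pi$ on $\mathbb F_n$. Moreover $\mathcal A_h(\mathbb G)$ and $\oplus_{k=n-r}^n\Lambda^k(\pi)$ are isomorphic as real vector spaces: a map $f:\mathbb G\to\mathbb R$ belongs to $\mathcal A_h(\mathbb G)$ if and only if there is $(\eta_{n-r},\dots,\eta_n)\in\oplus_{k=n-r}^n\Lambda^k(\pi)$ (with $\eta_k\in\Lambda^k(\pi)$) such that $f=\sum_{k=n-r}^n\psi_{\eta_k}$. Furthermore such $(\eta_{n-r},\dots,\eta_n)$ is unique and $\psi_{\eta_k}=f_{n-k}$ for all $k\in\{n-r,\dots,n\}$.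
   Context: A step-two Carnot group is $\mathbb G=V_1\times V_2$, where $V_1,V_2$ are finite-dimensional real vector spaces with $V_2\neq\{0\}$, equipped with a bilinear skew-symmetric map $[\cdot,\cdot]:V_1\times V_1\to V_2$ with $\operatorname{span}\{[x,x']:x,x'\in V_1\}=V_2$, and group law $(x,z)\cdot(x',z')=(x+x',z+z'+[x,x'])$. Its rank is $\dim V_1$. Dilations: $\delta_t(x,z)=(tx,t^2z)$ for $t>0$. A map $f:\mathbb G\to\mathbb R$ is $h$-affine, $f\in\mathcal A_h(\mathbb G)$, if for all $(x,z)\in\mathbb G$, $y\in V_1$, the map $t\in\mathbb R\mapsto f((x,z)\cdot(ty,0))$ is affine. The free step-two Carnot group of rank $n$ is $\mathbb F_n=\Lambda^1(\mathbb R^n)\times\Lambda^2(\mathbb R^n)$ ($\Lambda^k(\mathbb R^n)$ = alternating $k$-forms on $\mathbb R^n$) with bracket $[\theta,\theta']=\theta\wedge\theta'$. A Carnot morphism $\pi:\mathbb G\to\mathbb G'$ between step-two Carnot groups is a map $\pi(x,z)=(\pi_1(x),\pi_2(z))$ with $\pi_1:V_1\to V_1'$, $\pi_2:V_2\to V_2'$ linear and $\pi_2([x,y])=[\pi_1(x),\pi_1(y)]'$. For $\eta\in\Lambda^k(\mathbb R^n)$, $\operatorname{Anh}^{1,2}_\wedge\eta:=\{(\theta,\omega)\in\mathbb F_n:\theta\wedge\eta=0,\ \omega\wedge\eta=0\}$, and $\Lambda^k(\pi):=\{\eta\in\Lambda^k(\mathbb R^n):\ker\pi\subset\operatorname{Anh}^{1,2}_\wedge\eta\}$.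 For $m\in\{0,\dots,n\}$ and $\eta\in\Lambda^{n-m}(\mathbb R^n)$, $\widetilde\psi_\eta:\mathbb F_n\to\Lambda^n(\mathbb R^n)$ is defined by $\widetilde\psi_\eta(\theta,\omega)=\omega^{m/2}\wedge\eta$ if $m$ is even and $\widetilde\psi_\eta(\theta,\omega)=\theta\wedge\omega^{(m-1)/2}\wedge\eta$ if $m$ is odd ($\omega^j$ is the $j$-th exterior power, $\omega^0=1$). $\Lambda^n(\mathbb R^n)$-valued maps are identified with real-valued maps via the basis $dx_1\wedge\cdots\wedge dx_n$. *)

theory Defs
  imports "HOL-Analysis.Analysis"
begin

text \<open>A step-two Carnot group is modelled as V1 x V2 with V1 = 'a, V2 = 'b finite-dimensional
  real (Euclidean) spaces and a bracket br : V1 x V1 -> V2 that is bilinear, skew-symmetric and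
  whose image spans V2. (V2 is nonzero automatically, since euclidean_space types are nonzero.)
  The rank is DIM('a).\<close>

definition step2_carnot :: "('a::euclidean_space \<Rightarrow> 'a \<Rightarrow> 'b::euclidean_space) \<Rightarrow> bool" where
  "step2_carnot br \<longleftrightarrow> bilinear br \<and> (\<forall>x y. br x y = - br y x)
      \<and> span {br x y | x y. True} = UNIV"

definition gmult :: "('a::euclidean_space \<Rightarrow> 'a \<Rightarrow> 'b::euclidean_space)
    \<Rightarrow> 'a \<times> 'b \<Rightarrow> 'a \<times> 'b \<Rightarrow> 'a \<times> 'b" where
  "gmult br p q = (fst p + fst q, snd p + snd q + br (fst p) (fst q))"

definition dil :: "real \<Rightarrow> 'a::euclidean_space \<times> 'b::euclidean_space \<Rightarrow> 'a \<times> 'b" where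
  "dil t p = (t *\<^sub>R fst p, (t^2) *\<^sub>R snd p)"

definition h_affine :: "('a::euclidean_space \<Rightarrow> 'a \<Rightarrow> 'b::euclidean_space)
    \<Rightarrow> ('a \<times> 'b \<Rightarrow> real) \<Rightarrow> bool" where
  "h_affine br f \<longleftrightarrow> (\<forall>p y. \<exists>a b. \<forall>t::real. f (gmult br p (t *\<^sub>R y, 0)) = a + b * t)"

definition hcoeff :: "('a::euclidean_space \<times> 'b::euclidean_space \<Rightarrow> real) \<Rightarrow> nat
    \<Rightarrow> 'a \<times> 'b \<Rightarrow> real" where
  "hcoeff f j p = ((deriv ^^ j) (\<lambda>t. f (dil t p)) 0) / fact j"

text \<open>An element of the exterior algebra of R^n is represented by its coefficients with respect to
  the basis dx_I (I a subset of {0..<n}, listed increasingly): a map nat set => real.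
  Lambda^k(R^n) consists of those supported on k-element subsets of {..<n}.\<close>

type_synonym form = "nat set \<Rightarrow> real"

definition Lam :: "nat \<Rightarrow> nat \<Rightarrow> form set" where
  "Lam n k = {\<alpha>. \<forall>S. \<alpha> S \<noteq> 0 \<longrightarrow> S \<subseteq> {..<n} \<and> card S = k}"

definition form_zero :: form where "form_zero = (\<lambda>S. 0)"

definition form_one :: form where "form_one = (\<lambda>S. if S = {} then 1 else 0)"

definition form_add :: "form \<Rightarrow> form \<Rightarrow> form" where "form_add \<alpha> \<beta> = (\<lambda>S. \<alpha> S + \<beta> S)"

definition form_scale :: "real \<Rightarrow> form \<Rightarrow> form" where "form_scale c \<alpha> = (\<lambda>S. c * \<alpha> S)"

text \<open>Sign of dx_A wedge dx_B = sign * dx_(A union B) for disjoint A, B.\<close>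
definition shuffle_sign :: "nat set \<Rightarrow> nat set \<Rightarrow> real" where
  "shuffle_sign A B = (-1) ^ card {(a, b). a \<in> A \<and> b \<in> B \<and> b < a}"

definition wedge :: "form \<Rightarrow> form \<Rightarrow> form" where
  "wedge \<alpha> \<beta> = (\<lambda>S. \<Sum>A\<in>Pow S. shuffle_sign A (S - A) * \<alpha> A * \<beta> (S - A))"

fun wedge_pow :: "form \<Rightarrow> nat \<Rightarrow> form" where
  "wedge_pow \<omega> 0 = form_one"
| "wedge_pow \<omega> (Suc j) = wedge \<omega> (wedge_pow \<omega> j)"

text \<open>Identification Lambda^n(R^n) = R via the basis dx_1 wedge ... wedge dx_n.\<close>
definition top_coeff :: "nat \<Rightarrow> form \<Rightarrow> real" where
  "top_coeff n \<alpha> = \<alpha> {..<n}"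

text \<open>F_n = Lambda^1 x Lambda^2 with bracket the wedge product. A Carnot morphism
  pi = (pi1, pi2) : F_n -> G is given by maps pi1, pi2 that are linear on Lambda^1, Lambda^2
  and satisfy pi2 (theta wedge theta') = br (pi1 theta) (pi1 theta'). Only their values on
  Lambda^1 resp. Lambda^2 matter.\<close>

definition linear_on_forms :: "nat \<Rightarrow> nat \<Rightarrow> (form \<Rightarrow> 'v::real_vector) \<Rightarrow> bool" where
  "linear_on_forms n k L \<longleftrightarrow> (\<forall>u\<in>Lam n k. \<forall>v\<in>Lam n k. \<forall>a b.
      L (form_add (form_scale a u) (form_scale b v)) = a *\<^sub>R L u + b *\<^sub>R L v)"

definition free_carnot_morph :: "nat \<Rightarrow> ('a::euclidean_space \<Rightarrow> 'a \<Rightarrow> 'b::euclidean_space)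
    \<Rightarrow> (form \<Rightarrow> 'a) \<Rightarrow> (form \<Rightarrow> 'b) \<Rightarrow> bool" where
  "free_carnot_morph n br \<pi>1 \<pi>2 \<longleftrightarrow> linear_on_forms n 1 \<pi>1 \<and> linear_on_forms n 2 \<pi>2
     \<and> (\<forall>\<theta>\<in>Lam n 1. \<forall>\<theta>'\<in>Lam n 1. \<pi>2 (wedge \<theta> \<theta>') = br (\<pi>1 \<theta>) (\<pi>1 \<theta>'))"

definition surj_morph :: "nat \<Rightarrow> (form \<Rightarrow> 'a) \<Rightarrow> (form \<Rightarrow> 'b) \<Rightarrow> bool" where
  "surj_morph n \<pi>1 \<pi>2 \<longleftrightarrow> (\<lambda>(\<theta>, \<omega>). (\<pi>1 \<theta>, \<pi>2 \<omega>)) ` (Lam n 1 \<times> Lam n 2) = UNIV"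

definition ker_morph :: "nat \<Rightarrow> (form \<Rightarrow> 'a::zero) \<Rightarrow> (form \<Rightarrow> 'b::zero) \<Rightarrow> (form \<times> form) set" where
  "ker_morph n \<pi>1 \<pi>2 = {(\<theta>, \<omega>). \<theta> \<in> Lam n 1 \<and> \<omega> \<in> Lam n 2 \<and> \<pi>1 \<theta> = 0 \<and> \<pi>2 \<omega> = 0}"

definition Anh12 :: "nat \<Rightarrow> form \<Rightarrow> (form \<times> form) set" where
  "Anh12 n \<eta> = {(\<theta>, \<omega>). \<theta> \<in> Lam n 1 \<and> \<omega> \<in> Lam n 2
      \<and> wedge \<theta> \<eta> = form_zero \<and> wedge \<omega> \<eta> = form_zero}"

definition Lam_pi :: "nat \<Rightarrow> nat \<Rightarrow> (form \<Rightarrow> 'a::zero) \<Rightarrow> (form \<Rightarrow> 'b::zero) \<Rightarrow> form set" where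
  "Lam_pi n k \<pi>1 \<pi>2 = {\<eta> \<in> Lam n k. ker_morph n \<pi>1 \<pi>2 \<subseteq> Anh12 n \<eta>}"

text \<open>psi-tilde_eta for eta in Lambda^(n-m), as a real-valued map on F_n.\<close>
definition psitilde :: "nat \<Rightarrow> nat \<Rightarrow> form \<Rightarrow> form \<Rightarrow> form \<Rightarrow> real" where
  "psitilde n m \<eta> \<theta> \<omega> = top_coeff n
     (if even m then wedge (wedge_pow \<omega> (m div 2)) \<eta>
      else wedge (wedge \<theta> (wedge_pow \<omega> ((m - 1) div 2))) \<eta>)"

definition psi :: "nat \<Rightarrow> (form \<Rightarrow> 'a) \<Rightarrow> (form \<Rightarrow> 'b) \<Rightarrow> nat \<Rightarrow> form \<Rightarrow> 'a \<times> 'b \<Rightarrow> real" where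
  "psi n \<pi>1 \<pi>2 k \<eta> = (THE \<psi>. \<forall>\<theta>\<in>Lam n 1. \<forall>\<omega>\<in>Lam n 2.
      psitilde n (n - k) \<eta> \<theta> \<omega> = \<psi> (\<pi>1 \<theta>, \<pi>2 \<omega>))"

end

theory Submission
  imports Defs "HOL-Computational_Algebra.Polynomial"
begin

text \<open>A function on the Heisenberg group that is affine along horizontal lines is affine. Applied to
  the images of the Heisenberg group in \<open>G\<close>, this shows that right translations preserve h-affine
  functions, and that the horizontal difference operators \<open>D\<^sub>y f (p) = f (p y) - f p\<close> on them are
  linear in \<open>y\<close> and satisfy \<open>D\<^sub>y\<^sup>2 = 0\<close>. So the exterior algebra of \<open>V\<^sub>1\<close> acts on h-affine functions, translation
  by \<open>(\<theta>, \<omega>)\<close> acting as \<open>exp \<omega> \<and> (1 + \<theta>)\<close>. Hence an h-affine function on a quotient of the free group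
  has the form \<open>(\<theta>, \<omega>) \<mapsto> c (exp \<omega> \<and> (1 + \<theta>))\<close> for a unique linear functional \<open>c\<close> on the exterior algebra,
  whose homogeneous parts are the wedge products with the forms \<open>\<eta>\<^sub>k\<close>. The functional kills the two-sided
  ideal generated by the kernel of the morphism, which gives the annihilation condition on \<open>\<eta>\<^sub>k\<close>.
  Comparing with the free group on a basis of \<open>V\<^sub>1\<close> bounds the degree by the rank.\<close>

section \<open>Horizontal differences of h-affine functions\<close>

text \<open>No regularity of \<open>G\<close> is available, so the argument is incidence geometry of
  horizontal lines: at \<open>(x, y, z)\<close> their directions are the vectors
  \<open>(a, b, x * b - y * a)\<close>.\<close>

lemma heisenberg_affine:
  fixes G :: "real \<Rightarrow> real \<Rightarrow> real \<Rightarrow> real"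
  assumes "\<And>x y z a b. \<exists>u v. \<forall>t. G (x + t * a) (y + t * b) (z + t * (x * b - y * a)) = u + v * t"
  shows "\<exists>c0 c1 c2 c3. \<forall>x y z. G x y z = c0 + c1 * x + c2 * y + c3 * z"
proof -
  obtain g0 g1 where g: "\<And>s. G s 0 0 = g0 + g1 * s"
    using assms[of 0 1 0 0 0] by auto
  obtain h0 h1 where h: "\<And>s. G s 1 (- s) = h0 + h1 * s"
    using assms[of 0 1 1 0 0] by auto
  \<comment> \<open>\<open>H\<close> is \<open>G\<close> minus the affine function agreeing with it on the horizontal lines
    \<open>s \<mapsto> (s, 0, 0)\<close> and \<open>s \<mapsto> (s, 1, -s)\<close>. It vanishes on the surface ruled by the horizontal lines
    meeting both, and every point lies on a horizontal line meeting that surface twice.\<close>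
  define H where "H x y z = G x y z - (g0 + g1 * x + (h0 - g0) * y + (g1 - h1) * z)" for x y z
  have line: "\<exists>u v. \<forall>t. H (x + t * a) (y + t * b) (z + t * (x * b - y * a)) = u + v * t" for x y z a b
  proof -
    obtain u v where uv: "\<And>t. G (x + t * a) (y + t * b) (z + t * (x * b - y * a)) = u + v * t"
      using assms by metis
    have "H (x + t * a) (y + t * b) (z + t * (x * b - y * a))
        = (u - g0 - g1 * x - (h0 - g0) * y - (g1 - h1) * z)
          + (v - g1 * a - (h0 - g0) * b - (g1 - h1) * (x * b - y * a)) * t" for t
      unfolding H_def by (subst uv) algebra
    then show ?thesis by blast
  qed
  \<comment> \<open>An affine function of the line parameter with the two zeros 0 and
    \<open>t\<close> vanishes identically, in particular at parameter 1.\<close>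
  have two: "H (x + a) (y + b) (z + (x * b - y * a)) = 0"
    if "H x y z = 0" "H (x + t * a) (y + t * b) (z + t * (x * b - y * a)) = 0" "t \<noteq> 0" for x y z a b t
  proof -
    obtain u v where uv: "\<And>t. H (x + t * a) (y + t * b) (z + t * (x * b - y * a)) = u + v * t"
      using line by metis
    have "u = 0" using uv[of 0] that(1) by simp
    moreover have "v = 0" using uv[of t] that(2,3) calculation by simp
    ultimately show ?thesis using uv[of 1] by simp
  qed
  \<comment> \<open>This is the point with parameter \<open>t\<close> on the horizontal line from
    \<open>(s, 0, 0)\<close> to \<open>(- s, 1, s)\<close>, both zeros of \<open>H\<close>.\<close>
  have surf: "H (s * (1 - 2 * t)) t (t * s) = 0" for s t
  proof (cases "t = 0")
    case False
    have "H s 0 0 = 0" "H (- s) 1 s = 0"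
      using g[of s] h[of "- s"] by (simp_all add: H_def algebra_simps)
    then have "H (s + (- 2 * s * t)) (0 + t) (0 + (s * t - 0 * (- 2 * s * t))) = 0"
      using False by (intro two[of s 0 0 "1 / t"]) (simp_all add: field_simps)
    then show ?thesis by (simp add: algebra_simps)
  qed (use g[of s] in \<open>simp add: H_def\<close>)
  have zero: "H X Y Z = 0" for X Y Z
  proof -
    \<comment> \<open>Avoiding these values keeps the denominators of \<open>s\<close>,
      \<open>\<tau>\<close> and \<open>t'\<close> away from 0 and makes \<open>\<tau>\<close>
      nonzero.\<close>
    have "finite {0, 1, 1/2, Y, - Y / (1 - 2 * Y)}" by simp
    from ex_new_if_finite[OF infinite_UNIV_char_0 this]
    obtain t where t: "t \<noteq> 0" "t \<noteq> 1" "t \<noteq> 1/2" "t \<noteq> Y" "t \<noteq> - Y / (1 - 2 * Y)" by blast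
    have d: "t + (1 - 2 * t) * Y \<noteq> 0"
    proof
      assume a: "t + (1 - 2 * t) * Y = 0"
      then have "t * (1 - 2 * Y) = - Y" by algebra
      moreover have "1 - 2 * Y \<noteq> 0" using a by (cases "Y = 1/2") (auto simp: algebra_simps)
      ultimately show False using t(5) by (simp add: field_simps)
    qed
    \<comment> \<open>The choice that puts \<open>(X, Y, Z)\<close> on a horizontal line, with
      direction \<open>(A, B)\<close>, through the surface point with parameters \<open>s\<close>
      and \<open>t\<close>.\<close>
    define s where "s = (Z + t * X) / (t + (1 - 2 * t) * Y)"
    have s: "s * (t + (1 - 2 * t) * Y) = Z + t * X" using d by (simp add: s_def)
    define A where "A = X - s * (1 - 2 * t)"
    define B where "B = Y - t"
    \<comment> \<open>The surface lies on the quadric \<open>z * (1 - 2 * y) = x * y\<close>, so the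
      line has one further intersection with it. Its line parameter is \<open>\<tau>\<close>, and
      its surface parameters are \<open>x' * (1 - 2 * t)\<close> and \<open>t'\<close>.\<close>
    define \<tau> where "\<tau> = - 2 * t * (1 - t) / (B * (1 - 2 * t))"
    have nz: "B \<noteq> 0" "1 - 2 * t \<noteq> 0" using t by (auto simp: B_def)
    have \<tau>: "\<tau> * B * (1 - 2 * t) = - 2 * t * (1 - t)" using nz by (simp add: \<tau>_def)
    have \<tau>0: "\<tau> \<noteq> 0" using nz t by (simp add: \<tau>_def)
    define x' where "x' = s * (1 - 2 * t) + \<tau> * A"
    define t' where "t' = - t / (1 - 2 * t)"
    have t': "t' * (1 - 2 * t) = - t" using nz by (simp add: t'_def)
    have e1: "x' * (1 - 2 * t) * (1 - 2 * t') = x'" using t' by algebra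
    have "(t + \<tau> * B) * (1 - 2 * t) = - t" using \<tau> by algebra
    then have e2: "t + \<tau> * B = t'" using nz by (simp add: t'_def field_simps)
    have e3: "t * s + \<tau> * (s * (1 - 2 * t) * B - t * A) = t' * (x' * (1 - 2 * t))"
      using \<tau> t' unfolding x'_def by algebra
    have "H (s * (1 - 2 * t) + \<tau> * A) (t + \<tau> * B) (t * s + \<tau> * (s * (1 - 2 * t) * B - t * A)) = 0"
      using surf[of "x' * (1 - 2 * t)" t'] unfolding e1 e2 e3 x'_def[symmetric] by simp
    from two[OF surf this \<tau>0]
    have "H (s * (1 - 2 * t) + A) (t + B) (t * s + (s * (1 - 2 * t) * B - t * A)) = 0" .
    moreover have "t * s + (s * (1 - 2 * t) * B - t * A) = Z" using s unfolding A_def B_def by algebra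
    ultimately show ?thesis by (simp add: A_def B_def)
  qed
  show ?thesis using zero unfolding H_def by (metis eq_iff_diff_eq_0)
qed

lemma step2_carnotD:
  assumes "step2_carnot br"
  shows "bilinear br" "br x y = - br y x" "br x x = 0"
proof -
  show "bilinear br" and sk: "br x y = - br y x" for x y
    using assms unfolding step2_carnot_def by blast+
  have "br x x + br x x = 0" using sk[of x x] by (metis add.right_inverse)
  then show "br x x = 0" by (simp flip: scaleR_2)
qed

lemmas bilinear_simps = bilinear_ladd bilinear_radd bilinear_lmul bilinear_rmul bilinear_lzero
  bilinear_rzero bilinear_lneg bilinear_rneg

lemma gmult_assoc:
  assumes "bilinear br"
  shows "gmult br (gmult br p q) r = gmult br p (gmult br q r)"
  by (simp add: gmult_def bilinear_simps[OF assms] algebra_simps)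

text \<open>The vectors \<open>a\<close> and \<open>b\<close> induce a homomorphism from the
  Heisenberg group. Followed by left translation by \<open>p\<close>, it sends horizontal lines to
  horizontal lines, so \<open>heisenberg_affine\<close> applies.\<close>

lemma h_affine_on_plane:
  assumes G: "step2_carnot br" and f: "h_affine br f"
  shows "\<exists>c0 c1 c2 c3. \<forall>s t u. f (gmult br p (s *\<^sub>R a + t *\<^sub>R b, u *\<^sub>R br a b)) = c0 + c1 * s + c2 * t + c3 * u"
proof (rule heisenberg_affine)
  note bil = step2_carnotD(1)[OF G]
  fix x y z A B :: real
  have "br b a = - br a b" by (rule step2_carnotD(2)[OF G])
  then have "gmult br p ((x + t * A) *\<^sub>R a + (y + t * B) *\<^sub>R b, (z + t * (x * B - y * A)) *\<^sub>R br a b)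
      = gmult br (gmult br p (x *\<^sub>R a + y *\<^sub>R b, z *\<^sub>R br a b)) (t *\<^sub>R (A *\<^sub>R a + B *\<^sub>R b), 0)" for t
    unfolding gmult_assoc[OF bil]
    by (simp add: gmult_def bilinear_simps[OF bil] step2_carnotD(3)[OF G] algebra_simps)
  then show "\<exists>u v. \<forall>t. f (gmult br p ((x + t * A) *\<^sub>R a + (y + t * B) *\<^sub>R b,
      (z + t * (x * B - y * A)) *\<^sub>R br a b)) = u + v * t"
    using f unfolding h_affine_def by (simp only:)
qed

text \<open>On an h-affine function this finite difference equals the derivative along the
  left-invariant horizontal field of \<open>y\<close>, so no smoothness has to be
  established.\<close>

definition hdiff :: "('a::euclidean_space \<Rightarrow> 'a \<Rightarrow> 'b::euclidean_space) \<Rightarrow> 'a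
    \<Rightarrow> ('a \<times> 'b \<Rightarrow> real) \<Rightarrow> 'a \<times> 'b \<Rightarrow> real" where
  "hdiff br y f = (\<lambda>p. f (gmult br p (y, 0)) - f p)"

lemma gmult_horizontal:
  assumes "bilinear br"
  shows "gmult br (gmult br p (x, 0)) (y, 0) = gmult br p (x + y, br x y)"
  unfolding gmult_assoc[OF assms] by (simp add: gmult_def)

lemma gmult_zero_right:
  assumes "bilinear br"
  shows "gmult br p (0, 0) = p"
  by (simp add: gmult_def bilinear_simps[OF assms])

text \<open>In the plane of \<open>y\<close> and \<open>b\<close>, the product of
  \<open>(t y, 0)\<close> and \<open>(b, 0)\<close> has central coordinate \<open>t\<close>, which
  is still linear in \<open>t\<close>; the affine formula then makes the difference affine in
  \<open>t\<close>.\<close>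

lemma h_affine_hdiff:
  assumes G: "step2_carnot br" and f: "h_affine br f"
  shows "h_affine br (hdiff br b f)"
  unfolding h_affine_def
proof (intro allI)
  note bil = step2_carnotD(1)[OF G]
  fix p y
  obtain c0 c1 c2 c3 where "\<And>s t u. f (gmult br p (s *\<^sub>R y + t *\<^sub>R b, u *\<^sub>R br y b)) = c0 + c1 * s + c2 * t + c3 * u"
    using h_affine_on_plane[OF assms] by metis
  from this[of _ 1 _] this[of _ 0 0]
  have "hdiff br b f (gmult br p (t *\<^sub>R y, 0)) = c2 + c3 * t" for t
    by (simp add: hdiff_def gmult_horizontal[OF bil] bilinear_simps[OF bil])
  then show "\<exists>u v. \<forall>t. hdiff br b f (gmult br p (t *\<^sub>R y, 0)) = u + v * t" by blast
qed

lemma h_affine_step: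
  assumes "bilinear br" "h_affine br f"
  shows "f (gmult br p (t *\<^sub>R y, 0)) = f p + t * hdiff br y f p"
proof -
  obtain u v where uv: "\<And>t. f (gmult br p (t *\<^sub>R y, 0)) = u + v * t"
    using assms(2) unfolding h_affine_def by metis
  show ?thesis using uv[of 0] uv[of 1] uv[of t] by (simp add: hdiff_def gmult_zero_right[OF assms(1)])
qed

text \<open>In the affine formula both second differences isolate the central coefficient: the
  product in the order \<open>a\<close>, \<open>b\<close> gives \<open>c3\<close>, and the opposite
  order gives \<open>- c3\<close>.\<close>

lemma hdiff_anticommute:
  assumes G: "step2_carnot br" and f: "h_affine br f"
  shows "hdiff br a (hdiff br b f) = (\<lambda>p. - hdiff br b (hdiff br a f) p)"
proof
  note bil = step2_carnotD(1)[OF G]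
  fix p
  obtain c0 c1 c2 c3 where c: "\<And>s t u. f (gmult br p (s *\<^sub>R a + t *\<^sub>R b, u *\<^sub>R br a b)) = c0 + c1 * s + c2 * t + c3 * u"
    using h_affine_on_plane[OF assms] by metis
  have "br b a = - br a b" by (rule step2_carnotD(2)[OF G])
  then show "hdiff br a (hdiff br b f) p = - hdiff br b (hdiff br a f) p"
    using c[of 0 0 0] c[of 1 0 0] c[of 0 1 0] c[of 1 1 1] c[of 1 1 "-1"]
    by (simp add: hdiff_def gmult_horizontal[OF bil] gmult_zero_right[OF bil] add.commute)
qed

lemma hdiff_hdiff_self:
  assumes "step2_carnot br" "h_affine br f"
  shows "hdiff br a (hdiff br a f) = (\<lambda>p. 0)"
  using hdiff_anticommute[OF assms, of a a] by (metis neg_equal_zero)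

section \<open>Signs of shuffles\<close>

lemma finite_inversions:
  "finite A \<Longrightarrow> finite B \<Longrightarrow> finite {(a, b). a \<in> A \<and> b \<in> B \<and> b < a}"
  by (rule finite_subset[of _ "A \<times> B"]) auto

lemma shuffle_sign_Un_left:
  assumes "finite A" "finite B" "finite C" "A \<inter> B = {}"
  shows "shuffle_sign (A \<union> B) C = shuffle_sign A C * shuffle_sign B C"
proof -
  have "{(a, c). a \<in> A \<union> B \<and> c \<in> C \<and> c < a}
      = {(a, c). a \<in> A \<and> c \<in> C \<and> c < a} \<union> {(a, c). a \<in> B \<and> c \<in> C \<and> c < a}" by auto
  moreover have "{(a, c). a \<in> A \<and> c \<in> C \<and> c < a} \<inter> {(a, c). a \<in> B \<and> c \<in> C \<and> c < a} = {}"
    using assms(4) by auto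
  ultimately show ?thesis unfolding shuffle_sign_def
    using assms by (simp add: card_Un_disjoint finite_inversions power_add)
qed

lemma shuffle_sign_Un_right:
  assumes "finite A" "finite B" "finite C" "B \<inter> C = {}"
  shows "shuffle_sign A (B \<union> C) = shuffle_sign A B * shuffle_sign A C"
proof -
  have "{(a, c). a \<in> A \<and> c \<in> B \<union> C \<and> c < a}
      = {(a, c). a \<in> A \<and> c \<in> B \<and> c < a} \<union> {(a, c). a \<in> A \<and> c \<in> C \<and> c < a}" by auto
  moreover have "{(a, c). a \<in> A \<and> c \<in> B \<and> c < a} \<inter> {(a, c). a \<in> A \<and> c \<in> C \<and> c < a} = {}"
    using assms(4) by auto
  ultimately show ?thesis unfolding shuffle_sign_def
    using assms by (simp add: card_Un_disjoint finite_inversions power_add)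
qed

text \<open>The product \<open>A \<times> B\<close> is the disjoint union of the inversions of
  \<open>(A, B)\<close> and the transposed inversions of \<open>(B, A)\<close>.\<close>

lemma shuffle_sign_swap:
  assumes "finite A" "finite B" "A \<inter> B = {}"
  shows "shuffle_sign B A = (-1) ^ (card A * card B) * shuffle_sign A B"
proof -
  let ?I = "{(a, b). a \<in> A \<and> b \<in> B \<and> b < a}" and ?J = "{(b, a). b \<in> B \<and> a \<in> A \<and> a < b}"
  have "A \<times> B = ?I \<union> prod.swap ` ?J"
    using assms(3) by (auto simp: image_iff)
  moreover have "?I \<inter> prod.swap ` ?J = {}" by auto
  moreover have "finite ?I" "finite ?J" using assms by (simp_all add: finite_inversions)
  ultimately have "card (A \<times> B) = card ?I + card ?J"
    by (simp add: card_Un_disjoint card_image)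
  then have "card A * card B = card ?I + card ?J" by (simp only: card_cartesian_product)
  moreover have "(-1::real) ^ card ?I * (-1) ^ card ?I = 1"
    by (simp flip: power_add mult_2)
  ultimately show ?thesis unfolding shuffle_sign_def by (simp add: power_add)
qed

lemma shuffle_sign_square [simp]: "shuffle_sign A B * shuffle_sign A B = 1"
  unfolding shuffle_sign_def by (simp flip: power_add mult_2)

lemma shuffle_sign_nonzero [simp]: "shuffle_sign A B \<noteq> 0"
  by (simp add: shuffle_sign_def)

lemma shuffle_sign_empty [simp]: "shuffle_sign {} A = 1" "shuffle_sign A {} = 1"
  by (simp_all add: shuffle_sign_def)

section \<open>Taylor coefficients built from iterated horizontal differences\<close>

lemma hdiff_linear:
  "hdiff br y (\<lambda>p. a * f p + b * g p) = (\<lambda>p. a * hdiff br y f p + b * hdiff br y g p)"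
  by (simp add: hdiff_def fun_eq_iff algebra_simps)

text \<open>The value at the origin of the composite of the differences along the \<open>e i\<close> with \<open>i \<in> S\<close>,
  the smallest index being the outermost.\<close>
primrec taylor :: "('a::euclidean_space \<Rightarrow> 'a \<Rightarrow> 'b::euclidean_space) \<Rightarrow> (nat \<Rightarrow> 'a) \<Rightarrow> nat
    \<Rightarrow> nat set \<Rightarrow> ('a \<times> 'b \<Rightarrow> real) \<Rightarrow> real" where
  "taylor br e 0 S f = f (0, 0)"
| "taylor br e (Suc n) S f = (if n \<in> S then taylor br e n S (hdiff br (e n) f) else taylor br e n S f)"

lemma taylor_cong: "S \<inter> {..<n} = T \<inter> {..<n} \<Longrightarrow> taylor br e n S f = taylor br e n T f"
proof (induction n arbitrary: f)
  case (Suc n)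
  from Suc.prems have "n \<in> S \<longleftrightarrow> n \<in> T" "S \<inter> {..<n} = T \<inter> {..<n}" by (auto simp: set_eq_iff less_Suc_eq)
  then show ?case using Suc.IH by simp
qed simp

lemma taylor_linear:
  "taylor br e n S (\<lambda>p. a * f p + b * g p) = a * taylor br e n S f + b * taylor br e n S g"
  by (induction n arbitrary: f g) (simp_all add: hdiff_linear)

lemma taylor_zero: "taylor br e n S (\<lambda>p. 0) = 0"
  using taylor_linear[of br e n S 0 _ 0] by simp

lemma taylor_uminus: "taylor br e n S (\<lambda>p. - f p) = - taylor br e n S f"
  using taylor_linear[of br e n S "-1" f 0] by simp

lemma shuffle_sign_singleton_above: "(\<And>a. a \<in> S \<Longrightarrow> a \<le> i) \<Longrightarrow> shuffle_sign S {i} = 1"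
proof -
  assume "\<And>a. a \<in> S \<Longrightarrow> a \<le> i"
  then have "{(a, b). a \<in> S \<and> b \<in> {i} \<and> b < a} = {}" by fastforce
  then show ?thesis unfolding shuffle_sign_def by (simp only: card.empty power_0)
qed

lemma shuffle_sign_singletons: "i < j \<Longrightarrow> shuffle_sign {j} {i} = -1"
proof -
  assume "i < j"
  then have "{(a, b). a \<in> {j} \<and> b \<in> {i} \<and> b < a} = {(j, i)}" by auto
  then show ?thesis by (simp add: shuffle_sign_def)
qed

text \<open>The new difference is innermost. Moving it to its place passes the differences with
  larger index, one sign for each, and a repeated index gives 0. These are the rules for multiplying
  a basis form by \<open>dx_i\<close> on the right.\<close>

lemma taylor_hdiff:
  assumes "step2_carnot br" "h_affine br f" "i < n" "S \<subseteq> {..<n}"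
  shows "taylor br e n S (hdiff br (e i) f)
    = (if i \<in> S then 0 else shuffle_sign S {i} * taylor br e n (insert i S) f)"
  using assms(2-)
proof (induction n arbitrary: f S)
  case (Suc n)
  note G = assms(1)
  show ?case
  proof (cases "i = n")
    case True
    show ?thesis
    proof (cases "n \<in> S")
      case False
      then have "shuffle_sign S {n} = 1"
        using Suc.prems(3) by (intro shuffle_sign_singleton_above) auto
      moreover have "taylor br e n (insert n S) (hdiff br (e n) f) = taylor br e n S (hdiff br (e n) f)"
        by (rule taylor_cong) auto
      ultimately show ?thesis using True False by simp
    qed (simp add: True hdiff_hdiff_self[OF G Suc.prems(1)] taylor_zero)
  next
    case False
    with Suc.prems have i: "i < n" by simp
    show ?thesis
    proof (cases "n \<in> S")
      case True
      define T where "T = S - {n}"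
      have T: "S = insert n T" "n \<notin> T" "T \<subseteq> {..<n}" using True Suc.prems(3) by (auto simp: T_def)
      have fin: "finite T" using T(3) finite_subset by blast
      have sg: "shuffle_sign S {i} = - shuffle_sign T {i}"
        using shuffle_sign_Un_left[of T "{n}" "{i}"] fin T i by (simp add: shuffle_sign_singletons)
      have "taylor br e n S (hdiff br (e n) (hdiff br (e i) f))
          = - taylor br e n S (hdiff br (e i) (hdiff br (e n) f))"
        unfolding hdiff_anticommute[OF G Suc.prems(1), of "e n" "e i"] by (rule taylor_uminus)
      also have "taylor br e n S (hdiff br (e i) (hdiff br (e n) f))
          = taylor br e n T (hdiff br (e i) (hdiff br (e n) f))"
        by (rule taylor_cong) (auto simp: T_def)
      also have "\<dots> = (if i \<in> T then 0 else shuffle_sign T {i} * taylor br e n (insert i T) (hdiff br (e n) f))"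
        using Suc.IH[OF h_affine_hdiff[OF G Suc.prems(1)] i T(3)] .
      also have "taylor br e n (insert i T) (hdiff br (e n) f) = taylor br e n (insert i S) (hdiff br (e n) f)"
        by (rule taylor_cong) (auto simp: T_def)
      finally show ?thesis using True False sg by (auto simp: T_def)
    next
      case nS: False
      then have "S \<subseteq> {..<n}" using Suc.prems(3) by (auto simp: less_Suc_eq)
      from Suc.IH[OF Suc.prems(1) i this] show ?thesis using nS False by simp
    qed
  qed
qed simp

section \<open>The exterior algebra\<close>

text \<open>Both sides are sums over the ordered partitions of \<open>S\<close> into three blocks,
  with equal signs by the multiplicativity of \<open>shuffle_sign\<close>. For infinite
  \<open>S\<close> both sides are 0, the default value of a sum over an infinite set.\<close>

lemma wedge_assoc: "wedge (wedge \<alpha> \<beta>) \<gamma> = wedge \<alpha> (wedge \<beta> \<gamma>)"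
proof
  fix S :: "nat set"
  show "wedge (wedge \<alpha> \<beta>) \<gamma> S = wedge \<alpha> (wedge \<beta> \<gamma>) S"
  proof (cases "finite S")
    case fin: True
    have "wedge (wedge \<alpha> \<beta>) \<gamma> S = (\<Sum>A\<in>Pow S. \<Sum>B\<in>Pow A. shuffle_sign A (S - A) *
        (shuffle_sign B (A - B) * \<alpha> B * \<beta> (A - B)) * \<gamma> (S - A))"
      by (simp add: wedge_def sum_distrib_left sum_distrib_right)
    also have "\<dots> = (\<Sum>(A, B)\<in>Sigma (Pow S) Pow. shuffle_sign A (S - A) *
        (shuffle_sign B (A - B) * \<alpha> B * \<beta> (A - B)) * \<gamma> (S - A))"
      using fin by (subst sum.Sigma) (auto intro: finite_subset)
    also have "\<dots> = (\<Sum>(B, C)\<in>(SIGMA B:Pow S. Pow (S - B)). shuffle_sign B (S - B) * \<alpha> B *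
        (shuffle_sign C (S - B - C) * \<beta> C * \<gamma> (S - B - C)))"
    proof (rule sum.reindex_bij_witness[where i = "\<lambda>(B, C). (B \<union> C, B)" and j = "\<lambda>(A, B). (B, A - B)"],
        goal_cases)
      case (5 p)
      then obtain A B where p: "p = (A, B)" "B \<subseteq> A" "A \<subseteq> S" by auto
      then have f: "finite B" "finite (A - B)" "finite (S - A)"
        using fin by (auto intro: finite_subset)
      have A: "B \<union> (A - B) = A" and SB: "(A - B) \<union> (S - A) = S - B" "S - B - (A - B) = S - A"
        using p by auto
      have "shuffle_sign A (S - A) = shuffle_sign B (S - A) * shuffle_sign (A - B) (S - A)"
        using shuffle_sign_Un_left[OF f] unfolding A by blast
      moreover have "shuffle_sign B (S - B) = shuffle_sign B (A - B) * shuffle_sign B (S - A)"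
        using shuffle_sign_Un_right[OF f] unfolding SB by blast
      ultimately show ?case by (simp add: p(1) SB)
    qed auto
    also have "\<dots> = wedge \<alpha> (wedge \<beta> \<gamma>) S"
      using fin by (subst sum.Sigma[symmetric]) (auto simp: wedge_def sum_distrib_left)
    finally show ?thesis .
  qed (simp add: wedge_def)
qed

lemma wedge_add_left: "wedge (form_add \<alpha> \<beta>) \<gamma> = form_add (wedge \<alpha> \<gamma>) (wedge \<beta> \<gamma>)"
  by (simp add: fun_eq_iff wedge_def form_add_def algebra_simps sum.distrib)

lemma wedge_add_right: "wedge \<gamma> (form_add \<alpha> \<beta>) = form_add (wedge \<gamma> \<alpha>) (wedge \<gamma> \<beta>)"
  by (simp add: fun_eq_iff wedge_def form_add_def algebra_simps sum.distrib)

lemma wedge_scale_left: "wedge (form_scale c \<alpha>) \<gamma> = form_scale c (wedge \<alpha> \<gamma>)"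
  by (simp add: fun_eq_iff wedge_def form_scale_def algebra_simps sum_distrib_left)

lemma wedge_scale_right: "wedge \<gamma> (form_scale c \<alpha>) = form_scale c (wedge \<gamma> \<alpha>)"
  by (simp add: fun_eq_iff wedge_def form_scale_def algebra_simps sum_distrib_left)

lemma wedge_zero [simp]: "wedge form_zero \<alpha> = form_zero" "wedge \<alpha> form_zero = form_zero"
  by (simp_all add: fun_eq_iff wedge_def form_zero_def)

lemma form_simps [simp]:
  "form_scale 1 \<alpha> = \<alpha>" "form_scale 0 \<alpha> = form_zero" "form_scale c form_zero = form_zero"
  "form_add \<alpha> form_zero = \<alpha>" "form_add form_zero \<alpha> = \<alpha>"
  by (simp_all add: fun_eq_iff form_add_def form_scale_def form_zero_def)

lemma Lam_zero [simp]: "form_zero \<in> Lam n k"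
  by (simp add: Lam_def form_zero_def)

lemma Lam_one [simp]: "form_one \<in> Lam n 0"
  by (auto simp: Lam_def form_one_def)

lemma Lam_add [intro]:
  assumes "\<alpha> \<in> Lam n k" "\<beta> \<in> Lam n k"
  shows "form_add \<alpha> \<beta> \<in> Lam n k"
  unfolding Lam_def
proof (intro CollectI allI impI)
  fix S assume "form_add \<alpha> \<beta> S \<noteq> 0"
  then have "\<alpha> S \<noteq> 0 \<or> \<beta> S \<noteq> 0" by (auto simp: form_add_def)
  then show "S \<subseteq> {..<n} \<and> card S = k" using assms by (auto simp: Lam_def)
qed

lemma Lam_scale [intro]: "\<alpha> \<in> Lam n k \<Longrightarrow> form_scale c \<alpha> \<in> Lam n k"
  by (auto simp: Lam_def form_scale_def)

lemma LamD: "\<alpha> \<in> Lam n k \<Longrightarrow> \<not> (S \<subseteq> {..<n} \<and> card S = k) \<Longrightarrow> \<alpha> S = 0"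
  by (auto simp: Lam_def)

lemma Lam_wedge [intro]:
  assumes "\<alpha> \<in> Lam n k" "\<beta> \<in> Lam n l"
  shows "wedge \<alpha> \<beta> \<in> Lam n (k + l)"
  unfolding Lam_def
proof (intro CollectI allI impI)
  fix S assume nz: "wedge \<alpha> \<beta> S \<noteq> 0"
  then obtain A where "A \<in> Pow S" "shuffle_sign A (S - A) * \<alpha> A * \<beta> (S - A) \<noteq> 0"
    unfolding wedge_def by (rule sum.not_neutral_contains_not_neutral)
  then have A: "A \<subseteq> S" and c: "A \<subseteq> {..<n}" "card A = k" "S - A \<subseteq> {..<n}" "card (S - A) = l"
    using assms by (auto simp: Lam_def)
  have "card (A \<union> (S - A)) = card A + card (S - A)"
    using c by (intro card_Un_disjoint) (auto intro: finite_subset)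
  moreover have "A \<union> (S - A) = S" using A by auto
  ultimately show "S \<subseteq> {..<n} \<and> card S = k + l" using c by auto
qed

lemma wedge_commute:
  assumes "\<alpha> \<in> Lam n k" "\<beta> \<in> Lam n l"
  shows "wedge \<beta> \<alpha> = form_scale ((-1) ^ (k * l)) (wedge \<alpha> \<beta>)"
proof
  fix S
  show "wedge \<beta> \<alpha> S = form_scale ((-1) ^ (k * l)) (wedge \<alpha> \<beta>) S"
    unfolding wedge_def form_scale_def sum_distrib_left
  proof (rule sum.reindex_bij_witness[where i = "\<lambda>A. S - A" and j = "\<lambda>A. S - A"], goal_cases)
    case (5 A)
    then have dd: "S - (S - A) = A" by auto
    show ?case
    proof (cases "\<alpha> (S - A) = 0 \<or> \<beta> A = 0")
      case False
      then have c: "A \<subseteq> {..<n}" "card A = l" "S - A \<subseteq> {..<n}" "card (S - A) = k"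
        using assms by (auto simp: Lam_def)
      then have "shuffle_sign A (S - A) = (-1) ^ (k * l) * shuffle_sign (S - A) A"
        by (metis Diff_disjoint Int_commute finite_lessThan finite_subset shuffle_sign_swap)
      then show ?thesis by (simp add: dd)
    qed (auto simp: dd)
  qed auto
qed

lemma wedge_commute_even:
  assumes "\<alpha> \<in> Lam n k" "\<beta> \<in> Lam n l" "even k"
  shows "wedge \<alpha> \<beta> = wedge \<beta> \<alpha>"
  using wedge_commute[OF assms(2,1)] assms(3) by simp

lemma wedge_self_odd:
  assumes "\<alpha> \<in> Lam n k" "odd k"
  shows "wedge \<alpha> \<alpha> = form_zero"
  using wedge_commute[OF assms(1,1)] assms(2) by (simp add: fun_eq_iff form_scale_def form_zero_def)

lemma wedge_one [simp]:
  assumes "\<alpha> \<in> Lam n k"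
  shows "wedge form_one \<alpha> = \<alpha>" "wedge \<alpha> form_one = \<alpha>"
proof -
  have "wedge form_one \<alpha> S = \<alpha> S" for S
  proof (cases "finite S")
    case True
    then have "(\<Sum>A\<in>Pow S. shuffle_sign A (S - A) * form_one A * \<alpha> (S - A))
        = (\<Sum>A\<in>{{}}. shuffle_sign A (S - A) * form_one A * \<alpha> (S - A))"
      by (intro sum.mono_neutral_right) (auto simp: form_one_def)
    then show ?thesis by (simp add: wedge_def form_one_def)
  next
    case False
    \<comment> \<open>On infinite sets \<open>wedge\<close> is 0 by default; membership in
      \<open>Lam\<close> makes \<open>\<alpha>\<close> vanish there too.\<close>
    then have "\<alpha> S = 0" using assms by (metis LamD finite_lessThan finite_subset)
    then show ?thesis using False by (simp add: wedge_def)
  qed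
  then show "wedge form_one \<alpha> = \<alpha>" by blast
  with wedge_commute_even[OF Lam_one assms] show "wedge \<alpha> form_one = \<alpha>" by simp
qed

lemma Lam_wedge_pow: "\<omega> \<in> Lam n 2 \<Longrightarrow> wedge_pow \<omega> j \<in> Lam n (2 * j)"
  by (induction j) (use Lam_wedge in fastforce)+

lemma Lam_eqI:
  assumes "\<alpha> \<in> Lam n k" "\<beta> \<in> Lam n k" "\<And>S. S \<subseteq> {..<n} \<Longrightarrow> card S = k \<Longrightarrow> \<alpha> S = \<beta> S"
  shows "\<alpha> = \<beta>"
proof
  fix S show "\<alpha> S = \<beta> S"
    using assms by (cases "S \<subseteq> {..<n} \<and> card S = k") (auto simp: LamD)
qed

section \<open>Basis forms and linear functionals on the exterior algebra\<close>

definition basis_form :: "nat set \<Rightarrow> form" where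
  "basis_form S = (\<lambda>T. if T = S then 1 else 0)"

lemma Lam_basis_form [intro]: "S \<subseteq> {..<n} \<Longrightarrow> card S = k \<Longrightarrow> basis_form S \<in> Lam n k"
  by (auto simp: basis_form_def Lam_def)

lemma wedge_basis_form_right:
  assumes "finite S"
  shows "wedge \<alpha> (basis_form B) S = (if B \<subseteq> S then shuffle_sign (S - B) B * \<alpha> (S - B) else 0)"
proof -
  have "wedge \<alpha> (basis_form B) S = (\<Sum>A\<in>{A. A \<subseteq> S \<and> S - A = B}. shuffle_sign A (S - A) * \<alpha> A)"
    unfolding wedge_def basis_form_def using assms
    by (subst sum.mono_neutral_cong_right) auto
  also have "{A. A \<subseteq> S \<and> S - A = B} = (if B \<subseteq> S then {S - B} else {})" by auto
  finally show ?thesis by (auto simp: double_diff)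
qed

lemma wedge_basis_form_left:
  assumes "finite S"
  shows "wedge (basis_form B) \<alpha> S = (if B \<subseteq> S then shuffle_sign B (S - B) * \<alpha> (S - B) else 0)"
proof -
  have "wedge (basis_form B) \<alpha> S = (\<Sum>A\<in>(if B \<subseteq> S then {B} else {}). shuffle_sign A (S - A) * \<alpha> (S - A))"
    unfolding wedge_def basis_form_def using assms
    by (intro sum.mono_neutral_cong_right) (auto split: if_splits)
  then show ?thesis by auto
qed

lemma wedge_basis_form:
  assumes "finite A" "finite B" "A \<inter> B = {}"
  shows "wedge (basis_form A) (basis_form B) = form_scale (shuffle_sign A B) (basis_form (A \<union> B))"
proof
  fix S show "wedge (basis_form A) (basis_form B) S = form_scale (shuffle_sign A B) (basis_form (A \<union> B)) S"
  proof (cases "finite S")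
    case True
    have "A \<subseteq> S \<and> S - A = B \<longleftrightarrow> S = A \<union> B" using assms(3) by auto
    moreover have "A \<union> B - A = B" using assms(3) by auto
    ultimately show ?thesis unfolding wedge_basis_form_left[OF True]
      by (simp add: form_scale_def basis_form_def) metis
  next
    case False
    then have "S \<noteq> A \<union> B" using assms by auto
    then show ?thesis using False by (simp add: wedge_def form_scale_def basis_form_def)
  qed
qed

text \<open>Induction on the finite support: one coefficient is removed at a time.\<close>

lemma Lam_induct [consumes 1, case_names zero add]:
  assumes "\<alpha> \<in> Lam n k" and zero: "P form_zero"
    and add: "\<And>\<alpha> c S. \<alpha> \<in> Lam n k \<Longrightarrow> P \<alpha> \<Longrightarrow> S \<subseteq> {..<n} \<Longrightarrow> card S = k
      \<Longrightarrow> P (form_add \<alpha> (form_scale c (basis_form S)))"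
  shows "P \<alpha>"
proof -
  have "finite X \<Longrightarrow> \<alpha> \<in> Lam n k \<Longrightarrow> {S. \<alpha> S \<noteq> 0} = X \<Longrightarrow> P \<alpha>" for X \<alpha>
  proof (induction X arbitrary: \<alpha> rule: finite_induct)
    case empty
    then have "\<alpha> = form_zero" by (auto simp: form_zero_def)
    then show ?case using zero by simp
  next
    case (insert S X)
    define \<beta> where "\<beta> = \<alpha>(S := 0)"
    have "\<alpha> S \<noteq> 0" using insert.prems by auto
    then have S: "S \<subseteq> {..<n}" "card S = k" using insert.prems by (auto simp: Lam_def)
    have \<beta>: "\<beta> \<in> Lam n k" using insert.prems by (auto simp: \<beta>_def Lam_def)
    moreover have "{S. \<beta> S \<noteq> 0} = X" using insert unfolding \<beta>_def by auto
    ultimately have "P (form_add \<beta> (form_scale (\<alpha> S) (basis_form S)))"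
      using insert.IH S by (intro add) auto
    also have "form_add \<beta> (form_scale (\<alpha> S) (basis_form S)) = \<alpha>"
      by (auto simp: \<beta>_def form_add_def form_scale_def basis_form_def)
    finally show ?case .
  qed
  moreover have "finite {S. \<alpha> S \<noteq> 0}"
    using assms(1) by (auto simp: Lam_def intro!: finite_subset[of _ "Pow {..<n}"])
  ultimately show ?thesis using assms(1) by blast
qed

text \<open>The linear functional on the exterior algebra with value \<open>c S\<close> on
  \<open>basis_form S\<close>. Only subsets of \<open>{..<n}\<close> enter, so the values of
  \<open>c\<close> elsewhere are irrelevant.\<close>

definition pairing :: "nat \<Rightarrow> form \<Rightarrow> form \<Rightarrow> real" where
  "pairing n c \<alpha> = (\<Sum>S\<in>Pow {..<n}. \<alpha> S * c S)"

text \<open>The transpose of right multiplication by \<open>dx_i\<close>. The coefficients obtained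
  follow the same rule as in \<open>taylor_hdiff\<close>.\<close>

lemma pairing_wedge_singleton:
  assumes "i < n"
  shows "pairing n c (wedge \<alpha> (basis_form {i}))
    = pairing n (\<lambda>S. if i \<in> S then 0 else shuffle_sign S {i} * c (insert i S)) \<alpha>"
proof -
  have "pairing n c (wedge \<alpha> (basis_form {i}))
      = (\<Sum>S\<in>Pow {..<n}. if i \<in> S then shuffle_sign (S - {i}) {i} * \<alpha> (S - {i}) * c S else 0)"
    unfolding pairing_def
    by (intro sum.cong) (auto simp: wedge_basis_form_right finite_subset[OF _ finite_lessThan])
  also have "\<dots> = (\<Sum>S\<in>{S\<in>Pow {..<n}. i \<in> S}. shuffle_sign (S - {i}) {i} * \<alpha> (S - {i}) * c S)"
    by (rule sum.inter_filter[symmetric]) simp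
  also have "\<dots> = (\<Sum>S\<in>{S\<in>Pow {..<n}. i \<notin> S}. \<alpha> S * (shuffle_sign S {i} * c (insert i S)))"
    using assms
    by (intro sum.reindex_bij_witness[where i = "insert i" and j = "\<lambda>S. S - {i}"])
      (auto simp: insert_absorb)
  also have "\<dots> = pairing n (\<lambda>S. if i \<in> S then 0 else shuffle_sign S {i} * c (insert i S)) \<alpha>"
    unfolding pairing_def by (subst sum.inter_filter) (auto intro!: sum.cong)
  finally show ?thesis .
qed

text \<open>Makes the action of the exterior algebra on h-affine functions concrete: a horizontal
  difference of \<open>f\<close> corresponds to a right wedge factor in the argument of the
  functional.\<close>

lemma pairing_taylor_wedge:
  assumes "step2_carnot br" "h_affine br f" "i < n"
  shows "pairing n (\<lambda>S. taylor br e n S f) (wedge \<alpha> (basis_form {i}))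
    = pairing n (\<lambda>S. taylor br e n S (hdiff br (e i) f)) \<alpha>"
  unfolding pairing_wedge_singleton[OF assms(3)] unfolding pairing_def
  by (intro sum.cong) (simp_all add: taylor_hdiff[OF assms])

section \<open>The exponential map of the free group\<close>

text \<open>Up to a factorial, the component of degree \<open>m\<close> of
  \<open>exp \<omega> \<and> (1 + \<theta>)\<close>.\<close>

definition lie_pow :: "nat \<Rightarrow> form \<Rightarrow> form \<Rightarrow> form" where
  "lie_pow m \<theta> \<omega> = (if even m then wedge_pow \<omega> (m div 2) else wedge \<theta> (wedge_pow \<omega> ((m - 1) div 2)))"

lemma psitilde_eq: "psitilde n m \<eta> \<theta> \<omega> = top_coeff n (wedge (lie_pow m \<theta> \<omega>) \<eta>)"
  by (simp add: psitilde_def lie_pow_def)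

lemma wedge_left_commute:
  assumes "\<alpha> \<in> Lam n k" "\<beta> \<in> Lam n l" "even k"
  shows "wedge \<alpha> (wedge \<beta> \<gamma>) = wedge \<beta> (wedge \<alpha> \<gamma>)"
  using wedge_commute_even[OF assms] by (metis wedge_assoc)

text \<open>Even forms commute, and the vanishing square of \<open>\<tau>\<close> cuts the binomial
  expansion after its linear term.\<close>

lemma wedge_pow_add:
  assumes \<omega>: "\<omega> \<in> Lam n 2" and \<tau>: "\<tau> \<in> Lam n 2" and sq: "wedge \<tau> \<tau> = form_zero"
  shows "wedge_pow (form_add \<omega> \<tau>) (Suc j)
    = form_add (wedge_pow \<omega> (Suc j)) (form_scale (real (Suc j)) (wedge \<tau> (wedge_pow \<omega> j)))"
proof (induction j)
  case 0
  have "form_add \<omega> \<tau> \<in> Lam n 2" using assms by blast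
  then show ?case using \<omega> \<tau> by simp
next
  case (Suc j)
  have "wedge \<tau> (wedge \<tau> \<beta>) = form_zero" for \<beta>
    using sq by (simp flip: wedge_assoc)
  then show ?case
    unfolding wedge_pow.simps(2)[of "form_add \<omega> \<tau>" "Suc j"] Suc.IH
    by (simp add: wedge_add_left wedge_add_right wedge_scale_right wedge_left_commute[OF \<omega> \<tau>])
      (simp add: fun_eq_iff form_add_def form_scale_def algebra_simps)
qed

text \<open>The increment \<open>\<theta> \<and> \<sigma>\<close> of the second component has square
  zero and is annihilated by \<open>\<theta>\<close> and \<open>\<sigma>\<close>, so only terms
  linear in \<open>\<sigma>\<close> survive. The factor is the exponent of \<open>\<omega>\<close>
  when the degree \<open>Suc m\<close> is even.\<close>

lemma lie_pow_step:
  assumes \<theta>: "\<theta> \<in> Lam n 1" and \<omega>: "\<omega> \<in> Lam n 2" and \<sigma>: "\<sigma> \<in> Lam n 1"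
  shows "lie_pow (Suc m) (form_add \<theta> \<sigma>) (form_add \<omega> (wedge \<theta> \<sigma>))
    = form_add (lie_pow (Suc m) \<theta> \<omega>)
        (form_scale (if even m then 1 else real (Suc m div 2)) (wedge (lie_pow m \<theta> \<omega>) \<sigma>))"
proof -
  define \<tau> where "\<tau> = wedge \<theta> \<sigma>"
  have \<tau>: "\<tau> \<in> Lam n 2" using Lam_wedge[OF \<theta> \<sigma>] by (simp add: \<tau>_def numeral_2_eq_2)
  have \<theta>\<theta>: "wedge \<theta> (wedge \<theta> \<beta>) = form_zero" and \<sigma>\<sigma>: "wedge \<sigma> (wedge \<sigma> \<beta>) = form_zero" for \<beta>
    using wedge_self_odd[OF \<theta>] wedge_self_odd[OF \<sigma>] by (simp_all flip: wedge_assoc)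
  have sk: "wedge \<sigma> (wedge \<theta> \<beta>) = form_scale (-1) (wedge \<theta> (wedge \<sigma> \<beta>))" for \<beta>
    using wedge_commute[OF \<theta> \<sigma>] by (simp flip: wedge_assoc wedge_scale_left)
  have sq: "wedge \<tau> \<tau> = form_zero"
    by (simp add: \<tau>_def wedge_assoc sk wedge_scale_right \<theta>\<theta>)
  note pow = wedge_pow_add[OF \<omega> \<tau> sq]
  show ?thesis unfolding \<tau>_def[symmetric]
  proof (cases "even m")
    case True
    then obtain j where m: "m = 2 * j" by auto
    have "wedge (form_add \<theta> \<sigma>) (wedge \<tau> \<beta>) = form_zero" for \<beta>
      by (simp add: \<tau>_def wedge_assoc wedge_add_left \<theta>\<theta> sk \<sigma>\<sigma>)
    then have "wedge (form_add \<theta> \<sigma>) (wedge_pow (form_add \<omega> \<tau>) j) = wedge (form_add \<theta> \<sigma>) (wedge_pow \<omega> j)"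
      by (cases j) (simp_all only: pow wedge_add_right wedge_scale_right form_simps wedge_pow.simps(1))
    then show "lie_pow (Suc m) (form_add \<theta> \<sigma>) (form_add \<omega> \<tau>) = form_add (lie_pow (Suc m) \<theta> \<omega>)
        (form_scale (if even m then 1 else real (Suc m div 2)) (wedge (lie_pow m \<theta> \<omega>) \<sigma>))"
      using wedge_commute_even[OF Lam_wedge_pow[OF \<omega>] \<sigma>, of j]
      by (simp add: lie_pow_def m wedge_add_left)
  next
    case False
    then obtain j where m: "m = Suc (2 * j)" by (metis oddE Suc_eq_plus1)
    have "wedge \<tau> (wedge_pow \<omega> j) = wedge (wedge \<theta> (wedge_pow \<omega> j)) \<sigma>"
      using wedge_commute_even[OF Lam_wedge_pow[OF \<omega>] \<sigma>, of j] by (simp add: \<tau>_def wedge_assoc)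
    then show "lie_pow (Suc m) (form_add \<theta> \<sigma>) (form_add \<omega> \<tau>) = form_add (lie_pow (Suc m) \<theta> \<omega>)
        (form_scale (if even m then 1 else real (Suc m div 2)) (wedge (lie_pow m \<theta> \<omega>) \<sigma>))"
      using pow[of j] by (simp add: lie_pow_def m)
  qed
qed

lemma lie_pow_scale: "lie_pow m (form_scale t \<theta>) (form_scale (t\<^sup>2) \<omega>) = form_scale (t ^ m) (lie_pow m \<theta> \<omega>)"
proof -
  have p: "wedge_pow (form_scale (t\<^sup>2) \<omega>) j = form_scale (t ^ (2 * j)) (wedge_pow \<omega> j)" for j
    by (induction j) (simp_all add: wedge_scale_left wedge_scale_right,
        simp add: form_scale_def algebra_simps power2_eq_square)
  show ?thesis
  proof (cases "even m")
    case False
    then obtain j where "m = Suc (2 * j)" by (metis oddE Suc_eq_plus1)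
    then show ?thesis by (simp add: lie_pow_def p wedge_scale_left wedge_scale_right)
        (simp add: form_scale_def algebra_simps)
  qed (simp add: lie_pow_def p)
qed

text \<open>The image of \<open>(\<theta>, \<omega>)\<close> in the exterior algebra under the exponential map,
  \<open>exp \<omega> \<and> (1 + \<theta>)\<close>; it turns right translations of the group into wedge products.\<close>
definition exp_form :: "form \<Rightarrow> form \<Rightarrow> form" where
  "exp_form \<theta> \<omega> S = lie_pow (card S) \<theta> \<omega> S / fact (card S div 2)"

lemma exp_form_scale: "exp_form (form_scale t \<theta>) (form_scale (t\<^sup>2) \<omega>) S = t ^ card S * exp_form \<theta> \<omega> S"
  unfolding exp_form_def lie_pow_scale by (simp add: form_scale_def)

lemma exp_form_zero: "finite S \<Longrightarrow> exp_form form_zero form_zero S = basis_form {} S"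
proof (cases "S = {}")
  case False
  assume "finite S"
  with False have "card S \<noteq> 0" by simp
  then have "lie_pow (card S) form_zero form_zero = form_zero"
    by (cases "card S div 2") (auto simp: lie_pow_def elim: oddE evenE)
  then show ?thesis using False by (simp add: exp_form_def basis_form_def form_zero_def)
qed (simp add: exp_form_def basis_form_def lie_pow_def form_one_def)

text \<open>Right translation by \<open>(\<sigma>, 0)\<close> multiplies the exponential by
  \<open>1 + \<sigma>\<close>.\<close>

lemma exp_form_step:
  assumes \<theta>: "\<theta> \<in> Lam n 1" and \<omega>: "\<omega> \<in> Lam n 2" and \<sigma>: "\<sigma> \<in> Lam n 1" and fin: "finite S"
  shows "exp_form (form_add \<theta> \<sigma>) (form_add \<omega> (wedge \<theta> \<sigma>)) S
    = exp_form \<theta> \<omega> S + wedge (exp_form \<theta> \<omega>) \<sigma> S"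
proof (cases "card S")
  case 0
  then have "S = {}" using fin by simp
  moreover have "\<sigma> {} = 0" using \<sigma> by (simp add: LamD)
  ultimately show ?thesis by (simp add: exp_form_def lie_pow_def wedge_def)
next
  case (Suc m)
  have "wedge (exp_form \<theta> \<omega>) \<sigma> S = wedge (lie_pow m \<theta> \<omega>) \<sigma> S / fact (m div 2)"
    unfolding wedge_def sum_divide_distrib
  proof (intro sum.cong refl)
    fix A assume A: "A \<in> Pow S"
    show "shuffle_sign A (S - A) * exp_form \<theta> \<omega> A * \<sigma> (S - A)
        = shuffle_sign A (S - A) * lie_pow m \<theta> \<omega> A * \<sigma> (S - A) / fact (m div 2)"
    proof (cases "\<sigma> (S - A) = 0")
      case False
      then have "card (S - A) = 1" using \<sigma> LamD by blast
      then have "card A = m" using A Suc fin by (simp add: card_Diff_subset finite_subset)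
      then show ?thesis by (simp add: exp_form_def)
    qed simp
  qed
  \<comment> \<open>The factorials in \<open>exp_form\<close> absorb the integer factor of
    \<open>lie_pow_step\<close>, so the same formula holds in odd and even degrees.\<close>
  moreover have "real (if even m then 1 else Suc m div 2) / fact (Suc m div 2) = 1 / fact (m div 2)"
    by (auto elim: oddE simp: field_simps)
  ultimately show ?thesis unfolding exp_form_def Suc lie_pow_step[OF \<theta> \<omega> \<sigma>]
    by (auto simp: form_add_def form_scale_def add_divide_distrib elim: oddE)
qed

text \<open>Every point of the free group is reached from the origin by horizontal moves along the
  basis directions; central displacements come from commutators.\<close>

lemma free_group_induct [consumes 2, case_names zero step]:
  assumes "\<theta> \<in> Lam n 1" "\<omega> \<in> Lam n 2" and zero: "P form_zero form_zero"
    and step: "\<And>\<theta> \<omega> t i. \<theta> \<in> Lam n 1 \<Longrightarrow> \<omega> \<in> Lam n 2 \<Longrightarrow> i < n \<Longrightarrow> P \<theta> \<omega> \<Longrightarrow>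
      P (form_add \<theta> (form_scale t (basis_form {i})))
        (form_add \<omega> (wedge \<theta> (form_scale t (basis_form {i}))))"
  shows "P \<theta> \<omega>"
  using assms(1,2)
proof (induction \<theta> arbitrary: \<omega> rule: Lam_induct)
  case zero
  from zero.prems show ?case
  proof (induction \<omega> rule: Lam_induct)
    case (add \<omega> c S)
    obtain i j where ij: "S = {i, j}" "i < j" "j < n"
    proof -
      obtain a b where ab: "S = {a, b}" "a \<noteq> b" using add.hyps(3) by (auto simp: card_2_iff)
      then have "min a b < max a b" "S = {min a b, max a b}" "max a b < n"
        using add.hyps(2) by (auto simp: min_def max_def)
      then show thesis using that by blast
    qed
    let ?i = "basis_form {i}" and ?j = "basis_form {j}"
    have L: "?i \<in> Lam n 1" "?j \<in> Lam n 1" using ij by (auto intro!: Lam_basis_form)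
    have S: "basis_form S = wedge ?i ?j"
      using ij wedge_basis_form[of "{i}" "{j}"] shuffle_sign_singleton_above[of "{i}" j]
      by (simp add: insert_commute)
    have ji: "wedge ?j ?i = form_scale (-1) (wedge ?i ?j)"
      using wedge_commute[OF L] by simp
    have ii: "wedge ?i ?i = form_zero" "wedge ?j ?j = form_zero"
      using L by (simp_all add: wedge_self_odd)
    \<comment> \<open>Four moves \<open>c/2 dx_i\<close>, \<open>dx_j\<close>,
      \<open>- c/2 dx_i\<close>, \<open>- dx_j\<close> return the first component to zero. The
      second and third each add \<open>c/2 dx_i \<and> dx_j\<close>, hence
      \<open>c / 2\<close>.\<close>
    define \<theta>1 where "\<theta>1 = form_scale (c / 2) ?i"
    define \<theta>2 where "\<theta>2 = form_add \<theta>1 (form_scale 1 ?j)"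
    define \<omega>2 where "\<omega>2 = form_add \<omega> (wedge \<theta>1 (form_scale 1 ?j))"
    have "P \<theta>1 \<omega>"
      using step[of form_zero \<omega> i "c / 2"] add ij by (simp add: \<theta>1_def)
    moreover have \<theta>1: "\<theta>1 \<in> Lam n 1" using L by (auto simp: \<theta>1_def)
    ultimately have "P \<theta>2 \<omega>2"
      unfolding \<theta>2_def \<omega>2_def using step[of \<theta>1 \<omega> j 1] add ij by blast
    moreover have \<theta>2: "\<theta>2 \<in> Lam n 1" using L \<theta>1 by (auto simp: \<theta>2_def)
    moreover have \<omega>2: "\<omega>2 \<in> Lam n 2"
      using add Lam_wedge[OF \<theta>1 L(2)] by (auto simp: \<omega>2_def numeral_2_eq_2)
    ultimately have "P (form_add \<theta>2 (form_scale (- c / 2) ?i))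
        (form_add \<omega>2 (wedge \<theta>2 (form_scale (- c / 2) ?i)))"
      using step[of \<theta>2 \<omega>2 i "- c / 2"] ij by simp
    moreover have "form_add \<theta>2 (form_scale (- c / 2) ?i) = ?j"
      by (simp add: \<theta>2_def \<theta>1_def fun_eq_iff form_add_def form_scale_def)
    moreover have "form_add \<omega>2 (wedge \<theta>2 (form_scale (- c / 2) ?i)) = form_add \<omega> (form_scale c (basis_form S))"
      by (simp add: \<theta>2_def \<omega>2_def \<theta>1_def S wedge_add_left wedge_scale_left wedge_scale_right ii ji)
        (simp add: fun_eq_iff form_add_def form_scale_def)
    ultimately have "P ?j (form_add \<omega> (form_scale c (basis_form S)))" by simp
    moreover have "form_add \<omega> (form_scale c (basis_form S)) \<in> Lam n 2"
      using add by (auto intro!: Lam_add Lam_scale Lam_basis_form)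
    ultimately have "P (form_add ?j (form_scale (- 1) ?j))
        (form_add (form_add \<omega> (form_scale c (basis_form S))) (wedge ?j (form_scale (- 1) ?j)))"
      using step[of ?j _ j "-1"] L ij by blast
    moreover have "form_add ?j (form_scale (- 1) ?j) = form_zero"
      by (simp add: fun_eq_iff form_add_def form_scale_def form_zero_def)
    ultimately show ?case by (simp add: wedge_scale_right ii)
  qed (rule assms(3))
next
  case (add \<theta> c S)
  then obtain i where S: "S = {i}" "i < n" by (auto simp: card_1_singleton_iff)
  let ?s = "wedge \<theta> (form_scale c (basis_form {i}))"
  have i: "basis_form {i} \<in> Lam n 1" using S by (auto intro!: Lam_basis_form)
  then have "?s \<in> Lam n 2" using Lam_wedge[OF add.hyps(1) Lam_scale] by (simp add: numeral_2_eq_2)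
  \<comment> \<open>The induction hypothesis is used at a central component corrected in advance, so
    that the next move ends exactly at \<open>\<omega>\<close>.\<close>
  then have \<omega>': "form_add \<omega> (form_scale (-1) ?s) \<in> Lam n 2" using add.prems by blast
  have "form_add (form_add \<omega> (form_scale (-1) ?s)) ?s = \<omega>"
    by (simp add: fun_eq_iff form_add_def form_scale_def)
  then show ?case using step[OF add.hyps(1) \<omega>' S(2) add.IH[OF \<omega>'], of c] S by simp
qed

section \<open>Functionals evaluated on the exponential\<close>

lemma pairing_cong: "(\<And>S. S \<subseteq> {..<n} \<Longrightarrow> \<alpha> S = \<beta> S) \<Longrightarrow> pairing n c \<alpha> = pairing n c \<beta>"
  by (simp add: pairing_def)

lemma pairing_add: "pairing n c (form_add \<alpha> \<beta>) = pairing n c \<alpha> + pairing n c \<beta>"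
  by (simp add: pairing_def form_add_def algebra_simps sum.distrib)

lemma pairing_scale: "pairing n c (form_scale a \<alpha>) = a * pairing n c \<alpha>"
  by (simp add: pairing_def form_scale_def algebra_simps sum_distrib_left)

lemma pairing_exp_form_step:
  assumes "\<theta> \<in> Lam n 1" "\<omega> \<in> Lam n 2" "\<sigma> \<in> Lam n 1"
  shows "pairing n c (exp_form (form_add \<theta> (form_scale t \<sigma>)) (form_add \<omega> (wedge \<theta> (form_scale t \<sigma>))))
    = pairing n c (exp_form \<theta> \<omega>) + t * pairing n c (wedge (exp_form \<theta> \<omega>) \<sigma>)"
proof -
  have "exp_form (form_add \<theta> (form_scale t \<sigma>)) (form_add \<omega> (wedge \<theta> (form_scale t \<sigma>))) S
      = form_add (exp_form \<theta> \<omega>) (form_scale t (wedge (exp_form \<theta> \<omega>) \<sigma>)) S" if "S \<subseteq> {..<n}" for S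
    using exp_form_step[OF assms(1,2) Lam_scale[OF assms(3)], of S t] that
    by (simp add: finite_subset[OF _ finite_lessThan] wedge_scale_right form_add_def)
  from pairing_cong[OF this] show ?thesis by (simp add: pairing_add pairing_scale)
qed

lemma pairing_exp_form_zero: "pairing n c (exp_form form_zero form_zero) = c {}"
proof -
  have "pairing n c (exp_form form_zero form_zero) = pairing n c (basis_form {})"
    by (rule pairing_cong) (simp add: exp_form_zero finite_subset[OF _ finite_lessThan])
  also have "\<dots> = (\<Sum>S\<in>Pow {..<n}. if S = {} then c {} else 0)"
    unfolding pairing_def by (rule sum.cong) (auto simp: basis_form_def)
  also have "\<dots> = c {}" by (subst sum.delta) auto
  finally show ?thesis .
qed

text \<open>The exponentials span the exterior algebra. The difference of a vanishing function along
  \<open>dx_i\<close> vanishes, and it has coefficients \<open>c'\<close> with \<open>c' S\<close>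
  equal to \<open>c (insert i S)\<close> up to sign, so induction on \<open>S\<close>
  applies.\<close>

lemma pairing_exp_form_eq_0:
  assumes "\<And>\<theta> \<omega>. \<theta> \<in> Lam n 1 \<Longrightarrow> \<omega> \<in> Lam n 2 \<Longrightarrow> pairing n c (exp_form \<theta> \<omega>) = 0"
    and "S \<subseteq> {..<n}"
  shows "c S = 0"
proof -
  have "finite S" using assms(2) finite_subset by blast
  then show ?thesis using assms
  proof (induction S arbitrary: c rule: finite_induct)
    case empty
    from empty.prems(1)[OF Lam_zero Lam_zero] show ?case by (simp add: pairing_exp_form_zero)
  next
    case (insert i S)
    define c' where "c' S = (if i \<in> S then 0 else shuffle_sign S {i} * c (insert i S))" for S
    have i: "i < n" "basis_form {i} \<in> Lam n 1" using insert.prems(2) by (auto intro!: Lam_basis_form)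
    have "pairing n c' (exp_form \<theta> \<omega>) = 0" if L: "\<theta> \<in> Lam n 1" "\<omega> \<in> Lam n 2" for \<theta> \<omega>
    proof -
      have "wedge \<theta> (basis_form {i}) \<in> Lam n 2"
        using Lam_wedge[OF L(1) i(2)] by (simp add: numeral_2_eq_2)
      then have "pairing n c (exp_form (form_add \<theta> (basis_form {i})) (form_add \<omega> (wedge \<theta> (basis_form {i})))) = 0"
        using L i by (intro insert.prems(1)) auto
      then show ?thesis
        using pairing_exp_form_step[OF L i(2), of c 1] insert.prems(1)[OF L]
        unfolding c'_def pairing_wedge_singleton[OF i(1), symmetric] by simp
    qed
    then have "c' S = 0" using insert by blast
    then show ?case using insert.hyps by (simp add: c'_def)
  qed
qed

lemma pairing_exp_form_scale:
  "pairing n c (exp_form (form_scale t \<theta>) (form_scale (t\<^sup>2) \<omega>))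
    = (\<Sum>j\<le>n. pairing n (\<lambda>S. if card S = j then c S else 0) (exp_form \<theta> \<omega>) * t ^ j)"
proof -
  have "(\<Sum>j\<le>n. pairing n (\<lambda>S. if card S = j then c S else 0) (exp_form \<theta> \<omega>) * t ^ j)
      = (\<Sum>S\<in>Pow {..<n}. \<Sum>j\<le>n. exp_form \<theta> \<omega> S * (if card S = j then c S else 0) * t ^ j)"
    unfolding pairing_def sum_distrib_right by (rule sum.swap)
  also have "\<dots> = (\<Sum>S\<in>Pow {..<n}. exp_form \<theta> \<omega> S * c S * t ^ card S)"
  proof (intro sum.cong refl)
    fix S assume "S \<in> Pow {..<n}"
    then have "card S \<in> {..n}" using card_mono[of "{..<n}" S] by auto
    moreover have "(\<Sum>j\<le>n. exp_form \<theta> \<omega> S * (if card S = j then c S else 0) * t ^ j)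
        = (\<Sum>j\<le>n. if j = card S then exp_form \<theta> \<omega> S * c S * t ^ card S else 0)"
      by (intro sum.cong) auto
    ultimately show "(\<Sum>j\<le>n. exp_form \<theta> \<omega> S * (if card S = j then c S else 0) * t ^ j)
        = exp_form \<theta> \<omega> S * c S * t ^ card S"
      by (simp add: sum.delta)
  qed
  also have "\<dots> = pairing n c (exp_form (form_scale t \<theta>) (form_scale (t\<^sup>2) \<omega>))"
    by (simp add: pairing_def exp_form_scale mult_ac)
  finally show ?thesis by simp
qed

section \<open>Poincare duality between coefficients and families of forms\<close>

text \<open>The forms of degree \<open>k\<close> Poincare dual to the coefficients \<open>c\<close>; the factorial turns the powers
  in \<^const>\<open>psitilde\<close> into the terms of the exponential series.\<close>
definition dual_form :: "nat \<Rightarrow> form \<Rightarrow> nat \<Rightarrow> form" where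
  "dual_form n c k B = (if B \<subseteq> {..<n} \<and> card B = k
     then shuffle_sign ({..<n} - B) B * c ({..<n} - B) / fact ((n - k) div 2) else 0)"

lemma Lam_dual_form: "dual_form n c k \<in> Lam n k"
  by (auto simp: Lam_def dual_form_def)

lemma card_compl_lessThan: "S \<subseteq> {..<n} \<Longrightarrow> card ({..<n} - S) = n - card S"
  by (simp add: card_Diff_subset finite_subset[OF _ finite_lessThan])

lemma card_le_of_subset_lessThan: "S \<subseteq> {..<n} \<Longrightarrow> card S \<le> n"
  using card_mono[of "{..<n}" S] by simp

lemma top_coeff_wedge_dual_form:
  assumes "\<beta> \<in> Lam n (n - k)" "k \<le> n"
  shows "top_coeff n (wedge \<beta> (dual_form n c k)) = pairing n c \<beta> / fact ((n - k) div 2)"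
  unfolding top_coeff_def wedge_def pairing_def sum_divide_distrib
proof (intro sum.cong refl)
  fix S assume S: "S \<in> Pow {..<n}"
  show "shuffle_sign S ({..<n} - S) * \<beta> S * dual_form n c k ({..<n} - S)
      = \<beta> S * c S / fact ((n - k) div 2)"
  proof (cases "\<beta> S = 0")
    case False
    then have "card S = n - k" using assms(1) LamD by blast
    then have "card ({..<n} - S) = k" using S assms(2) by (simp add: card_compl_lessThan)
    moreover have "{..<n} - ({..<n} - S) = S" using S by auto
    ultimately have "dual_form n c k ({..<n} - S)
        = shuffle_sign S ({..<n} - S) * c S / fact ((n - k) div 2)" by (simp add: dual_form_def)
    moreover have "shuffle_sign S ({..<n} - S) * \<beta> S * (shuffle_sign S ({..<n} - S) * c S / F)
        = (shuffle_sign S ({..<n} - S) * shuffle_sign S ({..<n} - S)) * (\<beta> S * c S / F)" for F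
      by (simp only: ac_simps times_divide_eq_right times_divide_eq_left)
    ultimately show ?thesis by simp
  qed simp
qed

text \<open>Inverse to \<open>dual_form\<close>: one coefficient function collects the forms of
  degrees \<open>l\<close> to \<open>n\<close>, with sign and factorial undone, and is 0 in the
  remaining degrees.\<close>

definition undual_form :: "nat \<Rightarrow> nat \<Rightarrow> (nat \<Rightarrow> form) \<Rightarrow> form" where
  "undual_form n l \<eta>s S = (if l \<le> n - card S
     then fact (card S div 2) * shuffle_sign S ({..<n} - S) * \<eta>s (n - card S) ({..<n} - S) else 0)"

text \<open>In the top coefficient, a set \<open>S\<close> can only meet the form of degree
  \<open>n - card S\<close>, so the sum over \<open>k\<close> collapses to one term for each
  \<open>S\<close>.\<close>

lemma sum_psitilde:
  assumes "\<And>k. k \<in> {l..n} \<Longrightarrow> \<eta>s k \<in> Lam n k"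
  shows "(\<Sum>k = l..n. psitilde n (n - k) (\<eta>s k) \<theta> \<omega>) = pairing n (undual_form n l \<eta>s) (exp_form \<theta> \<omega>)"
proof -
  have "(\<Sum>k = l..n. psitilde n (n - k) (\<eta>s k) \<theta> \<omega>)
      = (\<Sum>S\<in>Pow {..<n}. \<Sum>k = l..n. shuffle_sign S ({..<n} - S) * lie_pow (n - k) \<theta> \<omega> S * \<eta>s k ({..<n} - S))"
    unfolding psitilde_eq top_coeff_def wedge_def by (rule sum.swap)
  also have "\<dots> = pairing n (undual_form n l \<eta>s) (exp_form \<theta> \<omega>)"
    unfolding pairing_def
  proof (intro sum.cong refl)
    fix S assume "S \<in> Pow {..<n}"
    then have S: "S \<subseteq> {..<n}" by simp
    let ?t = "\<lambda>k. shuffle_sign S ({..<n} - S) * lie_pow (n - k) \<theta> \<omega> S * \<eta>s k ({..<n} - S)"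
    have "(\<Sum>k = l..n. ?t k) = (\<Sum>k = l..n. if k = n - card S then ?t k else 0)"
    proof (intro sum.cong refl)
      fix k assume "k \<in> {l..n}"
      then show "?t k = (if k = n - card S then ?t k else 0)"
        using LamD[OF assms, of k "{..<n} - S"] by (auto simp: card_compl_lessThan[OF S])
    qed
    also have "\<dots> = (if l \<le> n - card S then ?t (n - card S) else 0)"
      by (subst sum.delta) auto
    also have "\<dots> = exp_form \<theta> \<omega> S * undual_form n l \<eta>s S"
      using card_le_of_subset_lessThan[OF S] by (simp add: undual_form_def exp_form_def)
    finally show "(\<Sum>k = l..n. ?t k) = exp_form \<theta> \<omega> S * undual_form n l \<eta>s S" .
  qed
  finally show ?thesis .
qed

lemma sum_psitilde_dual_form:
  assumes "\<And>S. S \<subseteq> {..<n} \<Longrightarrow> n - card S < l \<Longrightarrow> c S = 0"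
  shows "(\<Sum>k = l..n. psitilde n (n - k) (dual_form n c k) \<theta> \<omega>) = pairing n c (exp_form \<theta> \<omega>)"
  unfolding sum_psitilde[OF Lam_dual_form] pairing_def
proof (intro sum.cong refl)
  fix S assume "S \<in> Pow {..<n}"
  then have S: "S \<subseteq> {..<n}" "{..<n} - ({..<n} - S) = S" by auto
  show "exp_form \<theta> \<omega> S * undual_form n l (dual_form n c) S = exp_form \<theta> \<omega> S * c S"
    using assms[OF S(1)] card_le_of_subset_lessThan[OF S(1)]
      shuffle_sign_square[of S "{..<n} - S"]
    by (auto simp: undual_form_def dual_form_def card_compl_lessThan[OF S(1)] S(2) simp flip: mult.assoc
        simp del: shuffle_sign_square)
qed

lemma undual_form_inject:
  assumes "\<And>k. k \<in> {l..n} \<Longrightarrow> \<eta>s k \<in> Lam n k" "\<And>k. k \<in> {l..n} \<Longrightarrow> \<eta>s' k \<in> Lam n k"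
    and "\<And>S. S \<subseteq> {..<n} \<Longrightarrow> undual_form n l \<eta>s S = undual_form n l \<eta>s' S" and k: "k \<in> {l..n}"
  shows "\<eta>s k = \<eta>s' k"
proof (rule Lam_eqI[OF assms(1)[OF k] assms(2)[OF k]])
  fix B assume B: "B \<subseteq> {..<n}" "card B = k"
  define S where "S = {..<n} - B"
  have S: "S \<subseteq> {..<n}" "{..<n} - S = B" "n - card S = k"
    using B k by (auto simp: S_def card_compl_lessThan)
  from assms(3)[OF S(1)] show "\<eta>s k B = \<eta>s' k B" using k by (simp add: undual_form_def S)
qed

text \<open>The polynomial identity is taken for all real \<open>t\<close>, not only positive ones,
  since \<open>hcoeff\<close> uses two-sided derivatives at 0.\<close>

lemma hcoeff_eq:
  assumes "\<And>t. f (dil t p) = (\<Sum>j\<le>N. d j * t ^ j)" "j \<le> N"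
  shows "hcoeff f j p = d j"
proof -
  define P where "P = (\<Sum>j\<le>N. monom (d j) j)"
  have "(\<lambda>t. f (dil t p)) = poly P"
    by (rule ext) (simp add: assms(1) P_def poly_sum poly_monom)
  moreover have "(deriv ^^ i) (poly P) = poly ((pderiv ^^ i) P)" for i
  proof (induction i)
    case (Suc i)
    have "deriv (poly Q) = poly (pderiv Q)" for Q :: "real poly"
      by (rule ext) (rule DERIV_imp_deriv, rule poly_DERIV)
    with Suc show ?case by simp
  qed simp
  moreover have "coeff P j = d j"
    using assms(2) by (simp add: P_def coeff_sum)
  ultimately show ?thesis unfolding hcoeff_def
    by (simp add: poly_0_coeff_0 coeff_higher_pderiv pochhammer_fact[symmetric])
qed

section \<open>Carnot morphisms from the free group\<close>

lemma linear_on_forms_add: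
  assumes "linear_on_forms n k L" "u \<in> Lam n k" "v \<in> Lam n k"
  shows "L (form_add u v) = L u + L v"
  using assms unfolding linear_on_forms_def by (metis form_simps(1) scaleR_one)

lemma linear_on_forms_scale:
  assumes "linear_on_forms n k L" "u \<in> Lam n k"
  shows "L (form_scale a u) = a *\<^sub>R L u"
proof -
  have "L (form_add (form_scale a u) (form_scale 0 u)) = a *\<^sub>R L u + 0 *\<^sub>R L u"
    using assms unfolding linear_on_forms_def by blast
  then show ?thesis by simp
qed

lemma linear_on_forms_zero: "linear_on_forms n k L \<Longrightarrow> L form_zero = 0"
  using linear_on_forms_scale[of n k L form_zero 0] by simp

lemma free_carnot_morphD:
  assumes "free_carnot_morph n br \<pi>1 \<pi>2"
  shows "linear_on_forms n 1 \<pi>1" "linear_on_forms n 2 \<pi>2"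
    "\<theta> \<in> Lam n 1 \<Longrightarrow> \<sigma> \<in> Lam n 1 \<Longrightarrow> \<pi>2 (wedge \<theta> \<sigma>) = br (\<pi>1 \<theta>) (\<pi>1 \<sigma>)"
  using assms unfolding free_carnot_morph_def by blast+

lemma Lam_wedge_1_1: "\<theta> \<in> Lam n 1 \<Longrightarrow> \<sigma> \<in> Lam n 1 \<Longrightarrow> wedge \<theta> \<sigma> \<in> Lam n 2"
  using Lam_wedge[of \<theta> n 1 \<sigma> 1] by (simp add: numeral_2_eq_2)

lemma free_carnot_morph_mult:
  assumes "free_carnot_morph n br \<pi>1 \<pi>2" "\<theta> \<in> Lam n 1" "\<omega> \<in> Lam n 2" "\<sigma> \<in> Lam n 1"
  shows "gmult br (\<pi>1 \<theta>, \<pi>2 \<omega>) (t *\<^sub>R \<pi>1 \<sigma>, 0)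
    = (\<pi>1 (form_add \<theta> (form_scale t \<sigma>)), \<pi>2 (form_add \<omega> (wedge \<theta> (form_scale t \<sigma>))))"
proof -
  have L: "linear_on_forms n 1 \<pi>1" "linear_on_forms n 2 \<pi>2"
    and "\<pi>2 (wedge \<theta> (form_scale t \<sigma>)) = br (\<pi>1 \<theta>) (\<pi>1 (form_scale t \<sigma>))"
    using free_carnot_morphD[OF assms(1)] assms(2) Lam_scale[OF assms(4)] by blast+
  then show ?thesis
    using assms(2-4) Lam_wedge_1_1[OF assms(2) Lam_scale[OF assms(4)], of t]
    by (simp add: gmult_def linear_on_forms_add[OF L(1)] linear_on_forms_add[OF L(2)]
        linear_on_forms_scale[OF L(1)] Lam_scale)
qed

lemma free_carnot_morph_dil:
  assumes "free_carnot_morph n br \<pi>1 \<pi>2" "\<theta> \<in> Lam n 1" "\<omega> \<in> Lam n 2"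
  shows "dil t (\<pi>1 \<theta>, \<pi>2 \<omega>) = (\<pi>1 (form_scale t \<theta>), \<pi>2 (form_scale (t\<^sup>2) \<omega>))"
  using linear_on_forms_scale[OF free_carnot_morphD(1)[OF assms(1)] assms(2)]
    linear_on_forms_scale[OF free_carnot_morphD(2)[OF assms(1)] assms(3)]
  by (simp add: dil_def)

text \<open>Along a horizontal move of length \<open>t\<close> both sides grow by \<open>t\<close>
  times the same expression for \<open>hdiff\<close> of \<open>f\<close>. The induction therefore
  runs over all h-affine functions at once.\<close>

lemma h_affine_exp_form:
  assumes G: "step2_carnot br" and M: "free_carnot_morph n br \<pi>1 \<pi>2" and "h_affine br f"
    and "\<theta> \<in> Lam n 1" "\<omega> \<in> Lam n 2"
  shows "f (\<pi>1 \<theta>, \<pi>2 \<omega>)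
    = pairing n (\<lambda>S. taylor br (\<lambda>i. \<pi>1 (basis_form {i})) n S f) (exp_form \<theta> \<omega>)"
  using assms(4,5,3)
proof (induction arbitrary: f rule: free_group_induct)
  case zero
  have "taylor br (\<lambda>i. \<pi>1 (basis_form {i})) k {} f = f (0, 0)" for k by (induction k) simp_all
  then show ?case
    using linear_on_forms_zero[OF free_carnot_morphD(1)[OF M]]
      linear_on_forms_zero[OF free_carnot_morphD(2)[OF M]]
    by (simp add: pairing_exp_form_zero)
next
  case (step \<theta> \<omega> t i)
  have i: "basis_form {i} \<in> Lam n 1" using step.hyps by (auto intro!: Lam_basis_form)
  let ?e = "\<lambda>i. \<pi>1 (basis_form {i})"
  have "f (gmult br (\<pi>1 \<theta>, \<pi>2 \<omega>) (t *\<^sub>R ?e i, 0)) = f (\<pi>1 \<theta>, \<pi>2 \<omega>) + t * hdiff br (?e i) f (\<pi>1 \<theta>, \<pi>2 \<omega>)"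
    by (rule h_affine_step[OF step2_carnotD(1)[OF G] step.prems])
  also have "f (\<pi>1 \<theta>, \<pi>2 \<omega>) = pairing n (\<lambda>S. taylor br ?e n S f) (exp_form \<theta> \<omega>)"
    using step.IH step.prems .
  also have "hdiff br (?e i) f (\<pi>1 \<theta>, \<pi>2 \<omega>)
      = pairing n (\<lambda>S. taylor br ?e n S f) (wedge (exp_form \<theta> \<omega>) (basis_form {i}))"
    unfolding pairing_taylor_wedge[OF G step.prems step.hyps(3), of ?e]
    using step.IH h_affine_hdiff[OF G step.prems] .
  finally show ?case
    unfolding free_carnot_morph_mult[OF M step.hyps(1,2) i] pairing_exp_form_step[OF step.hyps(1,2) i] .
qed

lemma surj_morphE:
  assumes "surj_morph n \<pi>1 \<pi>2"
  obtains \<theta> \<omega> where "\<theta> \<in> Lam n 1" "\<omega> \<in> Lam n 2" "p = (\<pi>1 \<theta>, \<pi>2 \<omega>)"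
proof -
  have "p \<in> (\<lambda>(\<theta>, \<omega>). (\<pi>1 \<theta>, \<pi>2 \<omega>)) ` (Lam n 1 \<times> Lam n 2)"
    using assms unfolding surj_morph_def by simp
  then show thesis using that by auto
qed

lemma h_affine_pairing:
  assumes M: "free_carnot_morph n br \<pi>1 \<pi>2" and surj: "surj_morph n \<pi>1 \<pi>2"
    and f: "\<And>\<theta> \<omega>. \<theta> \<in> Lam n 1 \<Longrightarrow> \<omega> \<in> Lam n 2 \<Longrightarrow> f (\<pi>1 \<theta>, \<pi>2 \<omega>) = pairing n c (exp_form \<theta> \<omega>)"
  shows "h_affine br f"
  unfolding h_affine_def
proof (intro allI)
  fix p y
  obtain \<theta> \<omega> where p: "\<theta> \<in> Lam n 1" "\<omega> \<in> Lam n 2" "p = (\<pi>1 \<theta>, \<pi>2 \<omega>)"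
    using surj_morphE[OF surj] .
  \<comment> \<open>Only the first component \<open>\<sigma>\<close> of the lift is needed, because
    the increment is horizontal.\<close>
  obtain \<sigma> \<omega>' where y: "\<sigma> \<in> Lam n 1" "(y, 0) = (\<pi>1 \<sigma>, \<pi>2 \<omega>')"
    using surj_morphE[OF surj] by metis
  then have y2: "y = \<pi>1 \<sigma>" by simp
  have "f (gmult br p (t *\<^sub>R y, 0))
      = pairing n c (exp_form \<theta> \<omega>) + pairing n c (wedge (exp_form \<theta> \<omega>) \<sigma>) * t" for t
    unfolding p(3) y2 free_carnot_morph_mult[OF M p(1,2) y(1)]
    using p(1,2) y(1) Lam_wedge_1_1[OF p(1) Lam_scale[OF y(1)]]
    by (subst f) (auto simp: pairing_exp_form_step)
  then show "\<exists>a b. \<forall>t. f (gmult br p (t *\<^sub>R y, 0)) = a + b * t" by blast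
qed

lemma h_affine_dil_polynomial:
  assumes "step2_carnot br" "free_carnot_morph n br \<pi>1 \<pi>2" "h_affine br f"
    and "\<theta> \<in> Lam n 1" "\<omega> \<in> Lam n 2"
  shows "f (dil t (\<pi>1 \<theta>, \<pi>2 \<omega>)) = (\<Sum>j\<le>n. pairing n (\<lambda>S. if card S = j
    then taylor br (\<lambda>i. \<pi>1 (basis_form {i})) n S f else 0) (exp_form \<theta> \<omega>) * t ^ j)"
  unfolding free_carnot_morph_dil[OF assms(2,4,5)] pairing_exp_form_scale[symmetric]
  using assms by (intro h_affine_exp_form) auto

lemma subspace_image_linear_on_forms:
  assumes "linear_on_forms n k L"
  shows "subspace (L ` Lam n k)"
proof (rule subspaceI)
  show "0 \<in> L ` Lam n k" using linear_on_forms_zero[OF assms] Lam_zero by (metis imageI)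
  fix x y assume "x \<in> L ` Lam n k" "y \<in> L ` Lam n k"
  then show "x + y \<in> L ` Lam n k"
    using linear_on_forms_add[OF assms] Lam_add by (smt (verit) image_iff)
next
  fix c x assume "x \<in> L ` Lam n k"
  then show "c *\<^sub>R x \<in> L ` Lam n k"
    using linear_on_forms_scale[OF assms] Lam_scale by (smt (verit) image_iff)
qed

text \<open>The image of \<open>\<pi>2\<close> is a subspace containing all brackets, and these span
  the second layer.\<close>

lemma surj_morphI:
  assumes G: "step2_carnot br" and M: "free_carnot_morph n br \<pi>1 \<pi>2" and "\<pi>1 ` Lam n 1 = UNIV"
  shows "surj_morph n \<pi>1 \<pi>2"
proof -
  have "{br x y |x y. True} \<subseteq> \<pi>2 ` Lam n 2"
  proof clarify
    fix x y
    obtain \<theta> \<sigma> where "\<theta> \<in> Lam n 1" "\<sigma> \<in> Lam n 1" "x = \<pi>1 \<theta>" "y = \<pi>1 \<sigma>"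
      using assms(3) by (metis UNIV_I imageE)
    then show "br x y \<in> \<pi>2 ` Lam n 2"
      using M Lam_wedge_1_1 unfolding free_carnot_morph_def by (metis imageI)
  qed
  moreover have "subspace (\<pi>2 ` Lam n 2)"
    using M by (intro subspace_image_linear_on_forms) (simp add: free_carnot_morph_def)
  ultimately have "\<pi>2 ` Lam n 2 = UNIV"
    using G span_minimal unfolding step2_carnot_def by (metis top.extremum_uniqueI)
  then show ?thesis
    using assms(3) unfolding surj_morph_def by (auto simp: set_eq_iff image_iff)
qed

section \<open>The free group on a basis of the first layer and the bound on the degree\<close>

lemma wedge_1_1_pair:
  assumes "\<theta> \<in> Lam n 1" "\<sigma> \<in> Lam n 1" "i < j"
  shows "wedge \<theta> \<sigma> {i, j} = \<theta> {i} * \<sigma> {j} - \<theta> {j} * \<sigma> {i}"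
proof -
  have "Pow {i, j} = {{}, {i}, {j}, {i, j}}" by auto
  moreover have "{i, j} - {i} = {j}" "{i, j} - {j} = {i}" using assms(3) by auto
  moreover have "\<theta> {} = 0" "\<sigma> {} = 0" using assms by (simp_all add: LamD)
  ultimately show ?thesis unfolding wedge_def
    using assms(3) shuffle_sign_singleton_above[of "{i}" j]
    by (simp add: shuffle_sign_singletons doubleton_eq_iff)
qed

text \<open>The universal property of the free group of rank \<open>DIM('a)\<close>: send its
  generators to a basis of the first layer.\<close>

lemma exists_surj_morph:
  fixes br :: "'a::euclidean_space \<Rightarrow> 'a \<Rightarrow> 'b::euclidean_space"
  assumes G: "step2_carnot br"
  shows "\<exists>(\<pi>1 :: form \<Rightarrow> 'a) (\<pi>2 :: form \<Rightarrow> 'b).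
    free_carnot_morph DIM('a) br \<pi>1 \<pi>2 \<and> surj_morph DIM('a) \<pi>1 \<pi>2"
proof -
  note bil = step2_carnotD(1)[OF G]
  define r where "r = DIM('a)"
  obtain e where e: "bij_betw e {..<r} (Basis :: 'a set)"
    using ex_bij_betw_nat_finite[OF finite_Basis] unfolding r_def by (metis atLeast0LessThan)
  define \<pi>1 :: "form \<Rightarrow> 'a" where "\<pi>1 \<theta> = (\<Sum>i<r. \<theta> {i} *\<^sub>R e i)" for \<theta>
  \<comment> \<open>The antisymmetric matrix of a 2-form; \<open>sgn\<close> makes the diagonal
    zero. Summing over all ordered pairs counts each 2-subset twice, whence the factor 1/2 in
    \<open>\<pi>2\<close>.\<close>
  define u where "u \<omega> i j = sgn (real j - real i) * \<omega> {i, j}" for \<omega> :: form and i j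
  define \<pi>2 :: "form \<Rightarrow> 'b" where "\<pi>2 \<omega> = (1/2) *\<^sub>R (\<Sum>i<r. \<Sum>j<r. u \<omega> i j *\<^sub>R br (e i) (e j))" for \<omega>
  have "linear_on_forms r 1 \<pi>1"
    unfolding linear_on_forms_def \<pi>1_def form_add_def form_scale_def
    by (simp add: scaleR_sum_right algebra_simps sum.distrib)
  moreover have "linear_on_forms r 2 \<pi>2"
    unfolding linear_on_forms_def \<pi>2_def u_def form_add_def form_scale_def
    by (simp add: scaleR_sum_right algebra_simps sum.distrib)
  moreover have "\<pi>2 (wedge \<theta> \<sigma>) = br (\<pi>1 \<theta>) (\<pi>1 \<sigma>)" if L: "\<theta> \<in> Lam r 1" "\<sigma> \<in> Lam r 1" for \<theta> \<sigma>
  proof -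
    have u: "u (wedge \<theta> \<sigma>) i j = \<theta> {i} * \<sigma> {j} - \<theta> {j} * \<sigma> {i}" for i j
      using wedge_1_1_pair[OF L, of i j] wedge_1_1_pair[OF L, of j i]
      by (cases i j rule: linorder_cases) (auto simp: u_def insert_commute)
    have "br (\<pi>1 \<theta>) (\<pi>1 \<sigma>) = (\<Sum>i<r. \<Sum>j<r. (\<theta> {i} * \<sigma> {j}) *\<^sub>R br (e i) (e j))"
      by (simp add: \<pi>1_def bilinear_sum[OF bil] bilinear_simps[OF bil] sum.cartesian_product mult.commute)
    moreover have "(\<Sum>i<r. \<Sum>j<r. (\<theta> {j} * \<sigma> {i}) *\<^sub>R br (e i) (e j))
        = - (\<Sum>i<r. \<Sum>j<r. (\<theta> {i} * \<sigma> {j}) *\<^sub>R br (e i) (e j))"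
    proof -
      have "(\<Sum>i<r. \<Sum>j<r. (\<theta> {j} * \<sigma> {i}) *\<^sub>R br (e i) (e j))
          = (\<Sum>j<r. \<Sum>i<r. (\<theta> {j} * \<sigma> {i}) *\<^sub>R br (e i) (e j))" by (rule sum.swap)
      also have "\<dots> = (\<Sum>j<r. \<Sum>i<r. - ((\<theta> {j} * \<sigma> {i}) *\<^sub>R br (e j) (e i)))"
        by (intro sum.cong refl, subst step2_carnotD(2)[OF G]) simp
      finally show ?thesis by (simp add: sum_negf)
    qed
    ultimately have "\<pi>2 (wedge \<theta> \<sigma>) = (1/2) *\<^sub>R (br (\<pi>1 \<theta>) (\<pi>1 \<sigma>) + br (\<pi>1 \<theta>) (\<pi>1 \<sigma>))"
      by (simp add: \<pi>2_def u scaleR_diff_left sum_subtractf)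
    then show ?thesis by (simp flip: scaleR_2)
  qed
  ultimately have M: "free_carnot_morph r br \<pi>1 \<pi>2" by (simp add: free_carnot_morph_def)
  have "\<pi>1 ` Lam r 1 = UNIV"
  proof (intro set_eqI iffI UNIV_I)
    fix x :: 'a
    define \<theta> :: form where "\<theta> S = (\<Sum>i<r. if S = {i} then x \<bullet> e i else 0)" for S
    have "\<theta> {i} = x \<bullet> e i" if "i < r" for i
      using that by (simp add: \<theta>_def)
    then have "\<pi>1 \<theta> = (\<Sum>i<r. (x \<bullet> e i) *\<^sub>R e i)" by (simp add: \<pi>1_def)
    also have "\<dots> = (\<Sum>b\<in>Basis. (x \<bullet> b) *\<^sub>R b)" by (rule sum.reindex_bij_betw[OF e])
    finally have "\<pi>1 \<theta> = x" by (simp add: euclidean_representation)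
    moreover have "\<theta> \<in> Lam r 1"
      unfolding Lam_def
    proof (intro CollectI allI impI)
      fix S assume "\<theta> S \<noteq> 0"
      then have "\<exists>i\<in>{..<r}. (if S = {i} then x \<bullet> e i else 0) \<noteq> 0"
        unfolding \<theta>_def by (rule contrapos_np) (simp add: sum.neutral)
      then obtain i where "i < r" "S = {i}" by (auto split: if_splits)
      then show "S \<subseteq> {..<r} \<and> card S = 1" by simp
    qed
    ultimately show "x \<in> \<pi>1 ` Lam r 1" by blast
  qed
  from surj_morphI[OF G M this] M show ?thesis unfolding r_def by blast
qed

text \<open>The expansion is taken over the free group of rank \<open>DIM('a)\<close>, whose
  exterior algebra has no forms of higher degree.\<close>

lemma h_affine_dil_degree:
  fixes br :: "'a::euclidean_space \<Rightarrow> 'a \<Rightarrow> 'b::euclidean_space"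
  assumes G: "step2_carnot br" and f: "h_affine br f"
  shows "\<exists>c::nat \<Rightarrow> real. \<forall>t. f (dil t p) = (\<Sum>j\<le>DIM('a). c j * t ^ j)"
proof -
  obtain \<pi>1 :: "form \<Rightarrow> 'a" and \<pi>2 :: "form \<Rightarrow> 'b" where M: "free_carnot_morph DIM('a) br \<pi>1 \<pi>2"
    and surj: "surj_morph DIM('a) \<pi>1 \<pi>2"
    using exists_surj_morph[OF G] by blast
  obtain \<theta> \<omega> where "\<theta> \<in> Lam DIM('a) 1" "\<omega> \<in> Lam DIM('a) 2" "p = (\<pi>1 \<theta>, \<pi>2 \<omega>)"
    using surj_morphE[OF surj] .
  then show ?thesis using h_affine_dil_polynomial[OF G M f] by fast
qed

text \<open>The polynomial in the dilation parameter obtained over rank \<open>n\<close> is compared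
  with the one of degree at most \<open>DIM('a)\<close>. Its higher coefficients vanish as
  functions, hence as functionals.\<close>

lemma taylor_eq_0:
  fixes br :: "'a::euclidean_space \<Rightarrow> 'a \<Rightarrow> 'b::euclidean_space"
  assumes G: "step2_carnot br" and f: "h_affine br f" and M: "free_carnot_morph n br \<pi>1 \<pi>2"
    and "DIM('a) \<le> n" "S \<subseteq> {..<n}" "DIM('a) < card S"
  shows "taylor br (\<lambda>i. \<pi>1 (basis_form {i})) n S f = 0"
proof -
  let ?c = "\<lambda>T. if card T = card S then taylor br (\<lambda>i. \<pi>1 (basis_form {i})) n T f else 0"
  have "?c S = 0"
  proof (rule pairing_exp_form_eq_0[where c = ?c, OF _ assms(5)])
    fix \<theta> \<omega> assume L: "\<theta> \<in> Lam n 1" "\<omega> \<in> Lam n 2"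
    obtain d :: "nat \<Rightarrow> real" where "\<And>t. f (dil t (\<pi>1 \<theta>, \<pi>2 \<omega>)) = (\<Sum>j\<le>DIM('a). d j * t ^ j)"
      using h_affine_dil_degree[OF G f] by blast
    moreover have "(\<Sum>j\<le>DIM('a). d j * t ^ j) = (\<Sum>j\<le>n. (if j \<le> DIM('a) then d j else 0) * t ^ j)" for t
      using assms(4) by (intro sum.mono_neutral_cong_left) auto
    ultimately have "\<forall>t. (\<Sum>j\<le>n. pairing n (\<lambda>T. if card T = j
        then taylor br (\<lambda>i. \<pi>1 (basis_form {i})) n T f else 0) (exp_form \<theta> \<omega>) * t ^ j)
        = (\<Sum>j\<le>n. (if j \<le> DIM('a) then d j else 0) * t ^ j)"
      using h_affine_dil_polynomial[OF G M f L] by simp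
    then show "pairing n ?c (exp_form \<theta> \<omega>) = 0"
      unfolding polyfun_eq_coeffs using card_le_of_subset_lessThan[OF assms(5)] assms(6) by force
  qed
  then show ?thesis by simp
qed

section \<open>The annihilation condition on the dual forms\<close>

lemma pairing_taylor_wedge_basis_form:
  assumes G: "step2_carnot br" and "S \<subseteq> {..<n}" and \<alpha>: "\<alpha> \<in> Lam n k"
    and zero: "\<And>f. h_affine br f \<Longrightarrow> pairing n (\<lambda>S. taylor br e n S f) \<alpha> = 0"
    and f: "h_affine br f"
  shows "pairing n (\<lambda>S. taylor br e n S f) (wedge \<alpha> (basis_form S)) = 0"
proof -
  have "finite S" using assms(2) finite_subset by blast
  then show ?thesis using assms(2) f
  proof (induction S arbitrary: f rule: finite_induct)
    case empty
    have "basis_form {} = form_one" by (auto simp: basis_form_def form_one_def)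
    then show ?case using zero empty \<alpha> by simp
  next
    case (insert i S)
    have "form_scale (shuffle_sign S {i}) (wedge \<alpha> (basis_form (insert i S)))
        = wedge (wedge \<alpha> (basis_form S)) (basis_form {i})"
      using wedge_basis_form[of S "{i}"] insert.hyps
      by (simp add: wedge_assoc wedge_scale_right)
    \<comment> \<open>The last factor is transferred to \<open>f\<close> as a horizontal difference,
      which is again h-affine. This is why the vanishing is assumed for all h-affine functions and
      not just one.\<close>
    moreover have "pairing n (\<lambda>S. taylor br e n S f) (wedge (wedge \<alpha> (basis_form S)) (basis_form {i})) = 0"
      using insert by (simp add: pairing_taylor_wedge[OF G] h_affine_hdiff[OF G])
    ultimately show ?case by (metis mult_eq_0_iff pairing_scale shuffle_sign_nonzero)
  qed
qed

text \<open>Along the dilations of a kernel element \<open>f\<close> is constant, so the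
  coefficients of positive degree vanish. Those of degrees 1 and 2 are the pairings with
  \<open>\<theta>\<close> and \<open>\<omega>\<close>.\<close>

lemma ker_morphD:
  assumes G: "step2_carnot br" and M: "free_carnot_morph n br \<pi>1 \<pi>2" and f: "h_affine br f"
    and ker: "(\<theta>, \<omega>) \<in> ker_morph n \<pi>1 \<pi>2"
  shows "pairing n (\<lambda>S. taylor br (\<lambda>i. \<pi>1 (basis_form {i})) n S f) \<theta> = 0"
    and "pairing n (\<lambda>S. taylor br (\<lambda>i. \<pi>1 (basis_form {i})) n S f) \<omega> = 0"
proof -
  let ?c = "\<lambda>S. taylor br (\<lambda>i. \<pi>1 (basis_form {i})) n S f"
  have L: "\<theta> \<in> Lam n 1" "\<omega> \<in> Lam n 2" "\<pi>1 \<theta> = 0" "\<pi>2 \<omega> = 0"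
    using ker by (auto simp: ker_morph_def)
  have "f (dil t (\<pi>1 \<theta>, \<pi>2 \<omega>)) = f (0, 0)" for t
    by (simp add: L dil_def)
  then have "\<forall>t. (\<Sum>j\<le>n. pairing n (\<lambda>S. if card S = j then ?c S else 0) (exp_form \<theta> \<omega>) * t ^ j) = f (0, 0)"
    using h_affine_dil_polynomial[OF G M f L(1,2)] by simp
  then have z: "pairing n (\<lambda>S. if card S = j then ?c S else 0) (exp_form \<theta> \<omega>) = 0" if "1 \<le> j" "j \<le> n" for j
    using that unfolding polyfun_eq_const by simp
  \<comment> \<open>Degrees above \<open>n\<close> are included because \<open>n\<close> may be
    smaller than 2.\<close>
  have z: "pairing n (\<lambda>S. if card S = j then ?c S else 0) (exp_form \<theta> \<omega>) = 0" if "1 \<le> j" for j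
  proof (cases "j \<le> n")
    case False
    have "card S \<noteq> j" if "S \<subseteq> {..<n}" for S
      using card_le_of_subset_lessThan[OF that] False by auto
    then show ?thesis by (simp add: pairing_def)
  qed (rule z[OF that])
  have "pairing n ?c \<theta> = pairing n (\<lambda>S. if card S = 1 then ?c S else 0) (exp_form \<theta> \<omega>)"
    unfolding pairing_def using L(1) by (intro sum.cong refl) (auto simp: exp_form_def lie_pow_def LamD)
  then show "pairing n ?c \<theta> = 0" using z[of 1] by simp
  have "pairing n ?c \<omega> = pairing n (\<lambda>S. if card S = 2 then ?c S else 0) (exp_form \<theta> \<omega>)"
    unfolding pairing_def using L(2) by (intro sum.cong refl) (auto simp: exp_form_def lie_pow_def LamD)
  then show "pairing n ?c \<omega> = 0" using z[of 2] by simp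
qed

text \<open>Each coefficient is tested by wedging with the complementary basis form. By duality this
  gives the functional on the ideal generated by \<open>\<alpha>\<close>, where it vanishes.\<close>

lemma wedge_dual_form_eq_0:
  assumes \<alpha>: "\<alpha> \<in> Lam n d" and "k \<le> n"
    and zero: "\<And>S. S \<subseteq> {..<n} \<Longrightarrow> pairing n c (wedge \<alpha> (basis_form S)) = 0"
  shows "wedge \<alpha> (dual_form n c k) = form_zero"
proof (rule Lam_eqI[OF Lam_wedge[OF \<alpha> Lam_dual_form] Lam_zero])
  fix B assume B: "B \<subseteq> {..<n}" "card B = d + k"
  define A where "A = {..<n} - B"
  have A: "A \<subseteq> {..<n}" "{..<n} - A = B" using B by (auto simp: A_def)
  have dk: "d + k \<le> n" using card_le_of_subset_lessThan[OF B(1)] B(2) by simp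
  have cA: "card A = n - (d + k)" using B by (simp add: A_def card_compl_lessThan)
  then have bA: "basis_form A \<in> Lam n (n - (d + k))" using A by blast
  have "shuffle_sign A B * wedge \<alpha> (dual_form n c k) B
      = top_coeff n (wedge (basis_form A) (wedge \<alpha> (dual_form n c k)))"
    using A by (simp add: top_coeff_def wedge_basis_form_left)
  also have "\<dots> = top_coeff n (wedge (wedge (basis_form A) \<alpha>) (dual_form n c k))"
    by (simp add: wedge_assoc)
  also have "\<dots> = pairing n c (wedge (basis_form A) \<alpha>) / fact ((n - k) div 2)"
    using Lam_wedge[OF bA \<alpha>] dk assms(2) by (intro top_coeff_wedge_dual_form) auto
  also have "pairing n c (wedge (basis_form A) \<alpha>) = 0"
    unfolding wedge_commute[OF \<alpha> bA] pairing_scale zero[OF A(1)] by simp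
  finally show "wedge \<alpha> (dual_form n c k) B = form_zero B" by (simp add: form_zero_def)
qed

lemma dual_form_taylor_in_Lam_pi:
  assumes G: "step2_carnot br" and M: "free_carnot_morph n br \<pi>1 \<pi>2" and f: "h_affine br f" and "k \<le> n"
  shows "dual_form n (\<lambda>S. taylor br (\<lambda>i. \<pi>1 (basis_form {i})) n S f) k \<in> Lam_pi n k \<pi>1 \<pi>2"
proof -
  have "(\<theta>, \<omega>) \<in> Anh12 n (dual_form n (\<lambda>S. taylor br (\<lambda>i. \<pi>1 (basis_form {i})) n S f) k)"
    if ker: "(\<theta>, \<omega>) \<in> ker_morph n \<pi>1 \<pi>2" for \<theta> \<omega>
  proof -
    have L: "\<theta> \<in> Lam n 1" "\<omega> \<in> Lam n 2" using ker by (auto simp: ker_morph_def)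
    show ?thesis unfolding Anh12_def using L ker_morphD[OF G M _ ker]
      by (auto intro!: wedge_dual_form_eq_0[OF _ assms(4)] pairing_taylor_wedge_basis_form[OF G _ _ _ f])
  qed
  then show ?thesis using Lam_dual_form unfolding Lam_pi_def by auto
qed

section \<open>Descent to the quotient and the decomposition of h-affine functions\<close>

lemma form_diff_eq: "form_add (form_add \<alpha> (form_scale (-1) \<beta>)) \<beta> = \<alpha>"
  by (simp add: fun_eq_iff form_add_def form_scale_def)

lemma linear_on_forms_diff_eq_0:
  assumes "linear_on_forms n k L" "u \<in> Lam n k" "v \<in> Lam n k" "L u = L v"
  shows "L (form_add u (form_scale (-1) v)) = 0"
  using assms by (simp add: linear_on_forms_add[OF assms(1)] linear_on_forms_scale[OF assms(1)] Lam_scale)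

text \<open>Two lifts of a point differ by a kernel element, which \<open>\<eta>\<close>
  annihilates. The factors are exchanged one by one, each being moved next to \<open>\<eta>\<close>
  by commuting it past even forms.\<close>

lemma psitilde_cong:
  assumes M: "free_carnot_morph n br \<pi>1 \<pi>2" and \<eta>: "\<eta> \<in> Lam_pi n k \<pi>1 \<pi>2"
    and L: "\<theta> \<in> Lam n 1" "\<theta>' \<in> Lam n 1" "\<omega> \<in> Lam n 2" "\<omega>' \<in> Lam n 2"
    and eq: "\<pi>1 \<theta> = \<pi>1 \<theta>'" "\<pi>2 \<omega> = \<pi>2 \<omega>'"
  shows "psitilde n m \<eta> \<theta> \<omega> = psitilde n m \<eta> \<theta>' \<omega>'"
proof -
  have "\<pi>1 (form_add \<theta> (form_scale (-1) \<theta>')) = 0" "\<pi>2 (form_add \<omega> (form_scale (-1) \<omega>')) = 0"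
    using M L eq unfolding free_carnot_morph_def by (metis linear_on_forms_diff_eq_0)+
  then have "(form_add \<theta> (form_scale (-1) \<theta>'), form_add \<omega> (form_scale (-1) \<omega>')) \<in> ker_morph n \<pi>1 \<pi>2"
    using L by (auto simp: ker_morph_def)
  then have "wedge (form_add \<theta> (form_scale (-1) \<theta>')) \<eta> = form_zero"
    "wedge (form_add \<omega> (form_scale (-1) \<omega>')) \<eta> = form_zero"
    using \<eta> by (auto simp: Lam_pi_def Anh12_def)
  then have \<theta>\<eta>: "wedge \<theta> \<eta> = wedge \<theta>' \<eta>" and \<omega>\<eta>: "wedge \<omega> \<eta> = wedge \<omega>' \<eta>"
    by (metis form_diff_eq form_simps(5) wedge_add_left)+
  have pow: "wedge (wedge_pow \<omega> j) \<eta> = wedge (wedge_pow \<omega>' j) \<eta>" for j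
  proof (induction j)
    case (Suc j)
    have "wedge (wedge_pow \<omega> (Suc j)) \<eta> = wedge \<omega> (wedge (wedge_pow \<omega>' j) \<eta>)"
      using Suc by (simp add: wedge_assoc)
    also have "\<dots> = wedge (wedge_pow \<omega>' j) (wedge \<omega>' \<eta>)"
      using wedge_left_commute[OF L(3) Lam_wedge_pow[OF L(4)]] \<omega>\<eta> by simp
    also have "\<dots> = wedge (wedge_pow \<omega>' (Suc j)) \<eta>"
      using wedge_left_commute[OF L(4) Lam_wedge_pow[OF L(4)]] by (simp add: wedge_assoc)
    finally show ?case .
  qed simp
  have "wedge \<theta> (wedge (wedge_pow \<omega>' j) \<eta>) = wedge \<theta>' (wedge (wedge_pow \<omega>' j) \<eta>)" for j
    using wedge_left_commute[OF Lam_wedge_pow[OF L(4)] L(1), of j \<eta>]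
      wedge_left_commute[OF Lam_wedge_pow[OF L(4)] L(2), of j \<eta>] \<theta>\<eta> by simp
  then show ?thesis by (simp add: psitilde_eq lie_pow_def wedge_assoc pow)
qed

lemma psi_ex1:
  assumes M: "free_carnot_morph n br \<pi>1 \<pi>2" and surj: "surj_morph n \<pi>1 \<pi>2" and \<eta>: "\<eta> \<in> Lam_pi n k \<pi>1 \<pi>2"
  shows "\<exists>!\<psi>. \<forall>\<theta>\<in>Lam n 1. \<forall>\<omega>\<in>Lam n 2. psitilde n (n - k) \<eta> \<theta> \<omega> = \<psi> (\<pi>1 \<theta>, \<pi>2 \<omega>)"
proof (rule ex_ex1I)
  have "\<forall>p. \<exists>\<theta> \<omega>. \<theta> \<in> Lam n 1 \<and> \<omega> \<in> Lam n 2 \<and> p = (\<pi>1 \<theta>, \<pi>2 \<omega>)"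
    using surj_morphE[OF surj] by metis
  then obtain a b where ab: "\<And>p. a p \<in> Lam n 1" "\<And>p. b p \<in> Lam n 2" "\<And>p. p = (\<pi>1 (a p), \<pi>2 (b p))"
    by metis
  have "psitilde n (n - k) \<eta> \<theta> \<omega> = psitilde n (n - k) \<eta> (a (\<pi>1 \<theta>, \<pi>2 \<omega>)) (b (\<pi>1 \<theta>, \<pi>2 \<omega>))"
    if "\<theta> \<in> Lam n 1" "\<omega> \<in> Lam n 2" for \<theta> \<omega>
    using ab(3)[of "(\<pi>1 \<theta>, \<pi>2 \<omega>)"] that ab(1,2) by (intro psitilde_cong[OF M \<eta>]) auto
  then show "\<exists>\<psi>. \<forall>\<theta>\<in>Lam n 1. \<forall>\<omega>\<in>Lam n 2. psitilde n (n - k) \<eta> \<theta> \<omega> = \<psi> (\<pi>1 \<theta>, \<pi>2 \<omega>)"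
    by (intro exI[of _ "\<lambda>p. psitilde n (n - k) \<eta> (a p) (b p)"]) blast
next
  fix \<psi> \<psi>' :: "_ \<Rightarrow> real"
  assume "\<forall>\<theta>\<in>Lam n 1. \<forall>\<omega>\<in>Lam n 2. psitilde n (n - k) \<eta> \<theta> \<omega> = \<psi> (\<pi>1 \<theta>, \<pi>2 \<omega>)"
    "\<forall>\<theta>\<in>Lam n 1. \<forall>\<omega>\<in>Lam n 2. psitilde n (n - k) \<eta> \<theta> \<omega> = \<psi>' (\<pi>1 \<theta>, \<pi>2 \<omega>)"
  then show "\<psi> = \<psi>'" using surj_morphE[OF surj] by (metis ext)
qed

lemma psi_morph:
  assumes "free_carnot_morph n br \<pi>1 \<pi>2" "surj_morph n \<pi>1 \<pi>2" "\<eta> \<in> Lam_pi n k \<pi>1 \<pi>2"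
    and "\<theta> \<in> Lam n 1" "\<omega> \<in> Lam n 2"
  shows "psi n \<pi>1 \<pi>2 k \<eta> (\<pi>1 \<theta>, \<pi>2 \<omega>) = psitilde n (n - k) \<eta> \<theta> \<omega>"
  using theI'[OF psi_ex1[OF assms(1-3)]] assms(4,5) unfolding psi_def by simp

text \<open>Homogeneity of degree \<open>n - k\<close> is what identifies the summands with the
  coefficients of \<open>f\<close> along dilations.\<close>

lemma psi_dil:
  assumes M: "free_carnot_morph n br \<pi>1 \<pi>2" and surj: "surj_morph n \<pi>1 \<pi>2" and \<eta>: "\<eta> \<in> Lam_pi n k \<pi>1 \<pi>2"
  shows "psi n \<pi>1 \<pi>2 k \<eta> (dil t p) = psi n \<pi>1 \<pi>2 k \<eta> p * t ^ (n - k)"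
proof -
  obtain \<theta> \<omega> where L: "\<theta> \<in> Lam n 1" "\<omega> \<in> Lam n 2" and p: "p = (\<pi>1 \<theta>, \<pi>2 \<omega>)"
    using surj_morphE[OF surj] .
  show ?thesis
    unfolding p free_carnot_morph_dil[OF M L]
    using L by (simp add: psi_morph[OF M surj \<eta>] Lam_scale psitilde_eq lie_pow_scale wedge_scale_left)
      (simp add: top_coeff_def form_scale_def)
qed

lemma psi_linear:
  assumes M: "free_carnot_morph n br \<pi>1 \<pi>2" and surj: "surj_morph n \<pi>1 \<pi>2"
    and \<eta>: "\<eta> \<in> Lam_pi n k \<pi>1 \<pi>2" "\<eta>' \<in> Lam_pi n k \<pi>1 \<pi>2"
  shows "psi n \<pi>1 \<pi>2 k (form_add (form_scale a \<eta>) (form_scale b \<eta>'))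
    = (\<lambda>p. a * psi n \<pi>1 \<pi>2 k \<eta> p + b * psi n \<pi>1 \<pi>2 k \<eta>' p)"
proof
  fix p
  obtain \<theta> \<omega> where L: "\<theta> \<in> Lam n 1" "\<omega> \<in> Lam n 2" and p: "p = (\<pi>1 \<theta>, \<pi>2 \<omega>)"
    using surj_morphE[OF surj] .
  have "ker_morph n \<pi>1 \<pi>2 \<subseteq> Anh12 n (form_add (form_scale a \<eta>) (form_scale b \<eta>'))"
  proof
    fix x assume "x \<in> ker_morph n \<pi>1 \<pi>2"
    then have "x \<in> Anh12 n \<eta>" "x \<in> Anh12 n \<eta>'" using \<eta> by (auto simp: Lam_pi_def)
    then show "x \<in> Anh12 n (form_add (form_scale a \<eta>) (form_scale b \<eta>'))"
      by (auto simp: Anh12_def wedge_add_right wedge_scale_right)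
  qed
  then have "form_add (form_scale a \<eta>) (form_scale b \<eta>') \<in> Lam_pi n k \<pi>1 \<pi>2"
    using \<eta> by (auto simp: Lam_pi_def)
  then show "psi n \<pi>1 \<pi>2 k (form_add (form_scale a \<eta>) (form_scale b \<eta>')) p
      = a * psi n \<pi>1 \<pi>2 k \<eta> p + b * psi n \<pi>1 \<pi>2 k \<eta>' p"
    unfolding p using L \<eta>
    by (simp add: psi_morph[OF M surj] psitilde_eq wedge_add_right wedge_scale_right)
      (simp add: top_coeff_def form_add_def form_scale_def)
qed

lemma psi_sum:
  assumes "free_carnot_morph n br \<pi>1 \<pi>2" "surj_morph n \<pi>1 \<pi>2"
    and "\<And>k. k \<in> {l..n} \<Longrightarrow> \<eta>s k \<in> Lam_pi n k \<pi>1 \<pi>2" and "\<theta> \<in> Lam n 1" "\<omega> \<in> Lam n 2"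
  shows "(\<Sum>k = l..n. psi n \<pi>1 \<pi>2 k (\<eta>s k) (\<pi>1 \<theta>, \<pi>2 \<omega>))
    = pairing n (undual_form n l \<eta>s) (exp_form \<theta> \<omega>)"
proof -
  have "\<eta>s k \<in> Lam n k" if "k \<in> {l..n}" for k using assms(3)[OF that] by (simp add: Lam_pi_def)
  from sum_psitilde[OF this] show ?thesis
    using psi_morph[OF assms(1,2) assms(3) assms(4,5)] by simp
qed

lemma h_affine_eq_sum_psi:
  fixes br :: "'a::euclidean_space \<Rightarrow> 'a \<Rightarrow> 'b::euclidean_space"
  assumes G: "step2_carnot br" and M: "free_carnot_morph n br \<pi>1 \<pi>2" and surj: "surj_morph n \<pi>1 \<pi>2"
    and n: "DIM('a) \<le> n" and f: "h_affine br f"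
  shows "\<exists>\<eta>s. (\<forall>k\<in>{n - DIM('a)..n}. \<eta>s k \<in> Lam_pi n k \<pi>1 \<pi>2)
    \<and> f = (\<lambda>p. \<Sum>k = n - DIM('a)..n. psi n \<pi>1 \<pi>2 k (\<eta>s k) p)"
proof -
  let ?c = "\<lambda>S. taylor br (\<lambda>i. \<pi>1 (basis_form {i})) n S f"
  let ?\<eta>s = "dual_form n ?c"
  have \<eta>s: "?\<eta>s k \<in> Lam_pi n k \<pi>1 \<pi>2" if "k \<in> {n - DIM('a)..n}" for k
    using dual_form_taylor_in_Lam_pi[OF G M f] that by simp
  have "f p = (\<Sum>k = n - DIM('a)..n. psi n \<pi>1 \<pi>2 k (?\<eta>s k) p)" for p
  proof -
    obtain \<theta> \<omega> where L: "\<theta> \<in> Lam n 1" "\<omega> \<in> Lam n 2" and p: "p = (\<pi>1 \<theta>, \<pi>2 \<omega>)"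
      using surj_morphE[OF surj] .
    have "f p = pairing n ?c (exp_form \<theta> \<omega>)"
      unfolding p by (rule h_affine_exp_form[OF G M f L])
    also have "\<dots> = (\<Sum>k = n - DIM('a)..n. psitilde n (n - k) (?\<eta>s k) \<theta> \<omega>)"
      \<comment> \<open>The degrees missing from the sum are those of sets with more than
        \<open>DIM('a)\<close> elements, where the Taylor coefficients vanish.\<close>
      by (rule sum_psitilde_dual_form[symmetric], rule taylor_eq_0[OF G f M n]) auto
    finally show ?thesis
      unfolding p using psi_morph[OF M surj \<eta>s L] by simp
  qed
  with \<eta>s show ?thesis by blast
qed

lemma h_affine_sum_psi:
  assumes "free_carnot_morph n br \<pi>1 \<pi>2" "surj_morph n \<pi>1 \<pi>2"
    and "\<And>k. k \<in> {l..n} \<Longrightarrow> \<eta>s k \<in> Lam_pi n k \<pi>1 \<pi>2"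
  shows "h_affine br (\<lambda>p. \<Sum>k = l..n. psi n \<pi>1 \<pi>2 k (\<eta>s k) p)"
  using psi_sum[OF assms] by (intro h_affine_pairing[OF assms(1,2)])

text \<open>Equal sums give functionals that agree on all exponentials. Since these span, the
  coefficients agree, and duality recovers each form.\<close>

lemma sum_psi_inject:
  assumes M: "free_carnot_morph n br \<pi>1 \<pi>2" and surj: "surj_morph n \<pi>1 \<pi>2"
    and \<eta>s: "\<And>k. k \<in> {l..n} \<Longrightarrow> \<eta>s k \<in> Lam_pi n k \<pi>1 \<pi>2" "\<And>k. k \<in> {l..n} \<Longrightarrow> \<eta>s' k \<in> Lam_pi n k \<pi>1 \<pi>2"
    and eq: "(\<lambda>p. \<Sum>k = l..n. psi n \<pi>1 \<pi>2 k (\<eta>s k) p) = (\<lambda>p. \<Sum>k = l..n. psi n \<pi>1 \<pi>2 k (\<eta>s' k) p)"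
    and k: "k \<in> {l..n}"
  shows "\<eta>s k = \<eta>s' k"
proof (rule undual_form_inject[OF _ _ _ k])
  show "\<eta>s k \<in> Lam n k" "\<eta>s' k \<in> Lam n k" if "k \<in> {l..n}" for k
    using \<eta>s that by (auto simp: Lam_pi_def)
  fix S assume S: "S \<subseteq> {..<n}"
  have "undual_form n l \<eta>s S - undual_form n l \<eta>s' S = 0"
  proof (rule pairing_exp_form_eq_0[OF _ S])
    fix \<theta> \<omega> assume L: "\<theta> \<in> Lam n 1" "\<omega> \<in> Lam n 2"
    have "pairing n (undual_form n l \<eta>s) (exp_form \<theta> \<omega>) = pairing n (undual_form n l \<eta>s') (exp_form \<theta> \<omega>)"
      using fun_cong[OF eq] psi_sum[OF M surj \<eta>s(1) L] psi_sum[OF M surj \<eta>s(2) L] by metis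
    then show "pairing n (\<lambda>S. undual_form n l \<eta>s S - undual_form n l \<eta>s' S) (exp_form \<theta> \<omega>) = 0"
      by (simp add: pairing_def right_diff_distrib sum_subtractf)
  qed
  then show "undual_form n l \<eta>s S = undual_form n l \<eta>s' S" by simp
qed

lemma hcoeff_sum_psi:
  assumes M: "free_carnot_morph n br \<pi>1 \<pi>2" and surj: "surj_morph n \<pi>1 \<pi>2"
    and \<eta>s: "\<And>k. k \<in> {l..n} \<Longrightarrow> \<eta>s k \<in> Lam_pi n k \<pi>1 \<pi>2" and k: "k \<in> {l..n}"
  shows "hcoeff (\<lambda>p. \<Sum>k = l..n. psi n \<pi>1 \<pi>2 k (\<eta>s k) p) (n - k) = psi n \<pi>1 \<pi>2 k (\<eta>s k)"
proof
  fix p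
  let ?d = "\<lambda>j. psi n \<pi>1 \<pi>2 (n - j) (\<eta>s (n - j)) p"
  have "(\<Sum>k = l..n. psi n \<pi>1 \<pi>2 k (\<eta>s k) (dil t p)) = (\<Sum>j\<le>n - l. ?d j * t ^ j)" for t
    using psi_dil[OF M surj \<eta>s]
    by (intro sum.reindex_bij_witness[where i = "\<lambda>j. n - j" and j = "\<lambda>k. n - k"]) (use k in auto)
  from hcoeff_eq[where f = "\<lambda>p. \<Sum>k = l..n. psi n \<pi>1 \<pi>2 k (\<eta>s k) p", OF this, of "n - k"]
  show "hcoeff (\<lambda>p. \<Sum>k = l..n. psi n \<pi>1 \<pi>2 k (\<eta>s k) p) (n - k) p = psi n \<pi>1 \<pi>2 k (\<eta>s k) p"
    using k by (simp add: diff_le_mono2)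
qed

text \<open>The isomorphism of vector spaces is expressed by linearity of each \<open>psi\<close>
  together with existence and uniqueness of the family of forms.\<close>

theorem theorem1p2:
  fixes br :: "'a::euclidean_space \<Rightarrow> 'a \<Rightarrow> 'b::euclidean_space"
  assumes G: "step2_carnot br"
  shows
    "(\<forall>f. h_affine br f \<longrightarrow>
        (\<forall>p. \<exists>c::nat \<Rightarrow> real. \<forall>t>0. f (dil t p) = (\<Sum>j\<le>DIM('a). c j * t ^ j)))
   \<and> (\<forall>n (\<pi>1 :: form \<Rightarrow> 'a) (\<pi>2 :: form \<Rightarrow> 'b).
        n \<ge> DIM('a) \<and> free_carnot_morph n br \<pi>1 \<pi>2 \<and> surj_morph n \<pi>1 \<pi>2 \<longrightarrow>
          (\<forall>k\<le>n. \<forall>\<eta>\<in>Lam_pi n k \<pi>1 \<pi>2. \<exists>!\<psi> :: 'a \<times> 'b \<Rightarrow> real.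
              \<forall>\<theta>\<in>Lam n 1. \<forall>\<omega>\<in>Lam n 2. psitilde n (n - k) \<eta> \<theta> \<omega> = \<psi> (\<pi>1 \<theta>, \<pi>2 \<omega>))
        \<and> (\<forall>k\<le>n. \<forall>\<eta>\<in>Lam_pi n k \<pi>1 \<pi>2. \<forall>\<eta>'\<in>Lam_pi n k \<pi>1 \<pi>2. \<forall>a b.
              psi n \<pi>1 \<pi>2 k (form_add (form_scale a \<eta>) (form_scale b \<eta>'))
                = (\<lambda>p. a * psi n \<pi>1 \<pi>2 k \<eta> p + b * psi n \<pi>1 \<pi>2 k \<eta>' p))
        \<and> (\<forall>f. h_affine br f \<longleftrightarrow>
              (\<exists>\<eta>s :: nat \<Rightarrow> form. (\<forall>k\<in>{n - DIM('a)..n}. \<eta>s k \<in> Lam_pi n k \<pi>1 \<pi>2)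
                 \<and> f = (\<lambda>p. \<Sum>k = n - DIM('a)..n. psi n \<pi>1 \<pi>2 k (\<eta>s k) p)))
        \<and> (\<forall>\<eta>s \<eta>s' :: nat \<Rightarrow> form.
              (\<forall>k\<in>{n - DIM('a)..n}. \<eta>s k \<in> Lam_pi n k \<pi>1 \<pi>2 \<and> \<eta>s' k \<in> Lam_pi n k \<pi>1 \<pi>2)
              \<and> (\<lambda>p. \<Sum>k = n - DIM('a)..n. psi n \<pi>1 \<pi>2 k (\<eta>s k) p)
                = (\<lambda>p. \<Sum>k = n - DIM('a)..n. psi n \<pi>1 \<pi>2 k (\<eta>s' k) p)
              \<longrightarrow> (\<forall>k\<in>{n - DIM('a)..n}. \<eta>s k = \<eta>s' k))
        \<and> (\<forall>f \<eta>s. (\<forall>k\<in>{n - DIM('a)..n}. \<eta>s k \<in> Lam_pi n k \<pi>1 \<pi>2)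
              \<and> f = (\<lambda>p. \<Sum>k = n - DIM('a)..n. psi n \<pi>1 \<pi>2 k (\<eta>s k) p)
              \<longrightarrow> (\<forall>k\<in>{n - DIM('a)..n}. psi n \<pi>1 \<pi>2 k (\<eta>s k) = hcoeff f (n - k))))"
proof (intro conjI allI impI, goal_cases)
  case (1 f p)
  obtain c :: "nat \<Rightarrow> real" where "\<forall>t. f (dil t p) = (\<Sum>j\<le>DIM('a). c j * t ^ j)"
    using h_affine_dil_degree[OF G 1] by blast
  then show ?case by auto
next
  case (2 n \<pi>1 \<pi>2 k)
  then have "free_carnot_morph n br \<pi>1 \<pi>2" "surj_morph n \<pi>1 \<pi>2" by simp_all
  then show ?case by (intro ballI psi_ex1)
next
  case (3 n \<pi>1 \<pi>2 k)
  then have "free_carnot_morph n br \<pi>1 \<pi>2" "surj_morph n \<pi>1 \<pi>2" by simp_all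
  then show ?case by (intro ballI allI psi_linear)
next
  case (4 n \<pi>1 \<pi>2 f)
  then have M: "free_carnot_morph n br \<pi>1 \<pi>2" "surj_morph n \<pi>1 \<pi>2" and n: "DIM('a) \<le> n" by simp_all
  show ?case
  proof
    assume "h_affine br f"
    then show "\<exists>\<eta>s. (\<forall>k\<in>{n - DIM('a)..n}. \<eta>s k \<in> Lam_pi n k \<pi>1 \<pi>2)
        \<and> f = (\<lambda>p. \<Sum>k = n - DIM('a)..n. psi n \<pi>1 \<pi>2 k (\<eta>s k) p)"
      by (rule h_affine_eq_sum_psi[OF G M n])
  qed (use h_affine_sum_psi[OF M, of "n - DIM('a)"] in blast)
next
  case (5 n \<pi>1 \<pi>2 \<eta>s \<eta>s')
  then have "free_carnot_morph n br \<pi>1 \<pi>2" "surj_morph n \<pi>1 \<pi>2" by simp_all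
  from sum_psi_inject[OF this, of "n - DIM('a)" \<eta>s \<eta>s'] show ?case using 5(2) by blast
next
  case (6 n \<pi>1 \<pi>2 f \<eta>s)
  then have "free_carnot_morph n br \<pi>1 \<pi>2" "surj_morph n \<pi>1 \<pi>2" by simp_all
  from hcoeff_sum_psi[OF this, of "n - DIM('a)" \<eta>s] show ?case using 6(2) by simp
qed

end
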